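(* For every integer $n\ge 4$, $$0\le C_n-\binom{\pi(n)+1}{2}\le n\bigl(\pi(\sqrt n)-1\bigr),$$ where the right-hand side is $O\!\left(n^{3/2}/\log n\right)$; and consequently, as $n\to\infty$, $$C_n\sim\binom{\pi(n)+1}{2}\sim\frac{\pi(n)^2}{2}\sim\frac{n^2}{2\log^2 n}.$$ In particular the lower bound $C_n\ge\binom{\pi(n)+1}{2}$ is asymptotically an equality.
   Context: $p_1=2<p_2=3<\cdots$ are the primes and $\pi(x)$ is the number of primes $\le x$. $K$ is a field containing $\mathbb{Q}$. For a positive integer $n$ put $r=\pi(n)$ and $S=K[x_1,\dots,x_r]$. The weight of a monomial $m=x_1^{a_1}\cdots x_r^{a_r}$ is $w(m)=\prod_i p_i^{a_i}$. $I_n\subset S$ is the monomial ideal generated by all monomials of weight $>n$, $G(I_n)$ is its minimal monomial generating set, and $C_n=\#G(I_n)$. *)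

theory Defs
  imports
    "HOL-Computational_Algebra.Primes"
    "HOL-Library.Infinite_Set"
    "HOL-Library.Poly_Mapping"
    "HOL-Library.Landau_Symbols"
    "HOL-Algebra.Ideal"
    Complex_Main
begin

definition prime_count :: "real \<Rightarrow> nat" where
  "prime_count x = card {p::nat. prime p \<and> real p \<le> x}"

text \<open>One-based: the first prime is 2. The value at 0 is irrelevant.\<close>
definition nth_prime :: "nat \<Rightarrow> nat" where
  "nth_prime i = enumerate {p. prime p} (i - 1)"

text \<open>
  A polynomial is a finitely supported map from exponent vectors to coefficients, and an exponent
  vector is a finitely supported map from variable indices to exponents. The polynomials in the
  variables with indices \<open>1, \<dots>, r\<close> are those whose exponent vectors are supported in \<open>{1..r}\<close>.
\<close>
type_synonym expvec = "nat \<Rightarrow>\<^sub>0 nat"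
type_synonym 'k mpoly = "expvec \<Rightarrow>\<^sub>0 'k"

definition exponents :: "nat \<Rightarrow> expvec set" where
  "exponents r = {a. Poly_Mapping.keys a \<subseteq> {1..r}}"

definition poly_ring :: "nat \<Rightarrow> ('k::field) mpoly ring" where
  "poly_ring r =
     \<lparr>carrier = {f. Poly_Mapping.keys f \<subseteq> exponents r}, mult = (*), one = 1, zero = 0, add = (+)\<rparr>"

lemma poly_ring_simps:
  "carrier (poly_ring r) = {f. Poly_Mapping.keys f \<subseteq> exponents r}"
  "x \<otimes>\<^bsub>poly_ring r\<^esub> y = x * y" "\<one>\<^bsub>poly_ring r\<^esub> = 1"
  "x \<oplus>\<^bsub>poly_ring r\<^esub> y = x + y" "\<zero>\<^bsub>poly_ring r\<^esub> = 0"
  by (simp_all add: poly_ring_def)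

lemma exponents_add: "a \<in> exponents r \<Longrightarrow> b \<in> exponents r \<Longrightarrow> a + b \<in> exponents r"
  using keys_add[of a b] by (auto simp: exponents_def)

lemma cring_poly_ring: "cring (poly_ring r :: ('k::field) mpoly ring)"
proof (rule cringI)
  show "abelian_group (poly_ring r :: 'k mpoly ring)"
  proof (rule abelian_groupI)
    fix f g :: "'k mpoly"
    assume "f \<in> carrier (poly_ring r)" "g \<in> carrier (poly_ring r)"
    then show "f \<oplus>\<^bsub>poly_ring r\<^esub> g \<in> carrier (poly_ring r)"
      using keys_add[of f g] by (auto simp: poly_ring_simps)
  next
    fix f :: "'k mpoly"
    assume "f \<in> carrier (poly_ring r)"
    then show "\<exists>g\<in>carrier (poly_ring r). g \<oplus>\<^bsub>poly_ring r\<^esub> f = \<zero>\<^bsub>poly_ring r\<^esub>"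
      by (intro bexI[of _ "- f"]) (auto simp: poly_ring_simps in_keys_iff)
  qed (auto simp: poly_ring_simps add_ac)
  show "comm_monoid (poly_ring r :: 'k mpoly ring)"
  proof (rule comm_monoidI)
    fix f g :: "'k mpoly"
    assume "f \<in> carrier (poly_ring r)" "g \<in> carrier (poly_ring r)"
    then show "f \<otimes>\<^bsub>poly_ring r\<^esub> g \<in> carrier (poly_ring r)"
      using keys_mult[of f g] by (fastforce simp: poly_ring_simps intro: exponents_add)
  qed (auto simp: poly_ring_simps exponents_def mult_ac)
qed (auto simp: poly_ring_simps algebra_simps)

definition monom :: "expvec \<Rightarrow> ('k::field) mpoly" where
  "monom a = Poly_Mapping.single a 1"

definition weight :: "expvec \<Rightarrow> nat" where
  "weight a = (\<Prod>i\<in>Poly_Mapping.keys a. nth_prime i ^ Poly_Mapping.lookup a i)"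

definition weight_ideal :: "nat \<Rightarrow> ('k::field) mpoly set" where
  "weight_ideal n =
     (let r = prime_count (real n)
      in Idl\<^bsub>poly_ring r\<^esub> (monom ` {a \<in> exponents r. weight a > n}))"

definition is_min_monomial_gens :: "nat \<Rightarrow> ('k::field) mpoly set \<Rightarrow> 'k mpoly set \<Rightarrow> bool" where
  "is_min_monomial_gens r I G \<longleftrightarrow>
     G \<subseteq> monom ` exponents r \<and> Idl\<^bsub>poly_ring r\<^esub> G = I \<and>
     (\<forall>H. H \<subset> G \<longrightarrow> Idl\<^bsub>poly_ring r\<^esub> H \<noteq> I)"

text \<open>Every monomial ideal has exactly one minimal set of monomial generators.\<close>
definition min_monomial_gens :: "nat \<Rightarrow> ('k::field) mpoly set \<Rightarrow> 'k mpoly set" where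
  "min_monomial_gens r I = (THE G. is_min_monomial_gens r I G)"

definition num_gens :: "'k::field itself \<Rightarrow> nat \<Rightarrow> nat" where
  "num_gens K n =
     card (min_monomial_gens (prime_count (real n)) (weight_ideal n :: 'k mpoly set))"

end

theory Submission
  imports "HOL-Complex_Analysis.Complex_Analysis" "HOL-Number_Theory.Prime_Powers"
    "HOL-Real_Asymp.Real_Asymp" Defs
begin

text \<open>
  Minimal generators of \<open>I\<^sub>n\<close> correspond under the weight to the integers \<open>N > n\<close> with all prime
  factors \<open>\<le> n\<close> and no proper divisor exceeding \<open>n\<close>. Such an \<open>N\<close> is \<open>p\<^sup>a m\<close> with \<open>p\<close> its least prime
  factor, all prime factors of \<open>m \<le> n\<close> larger than \<open>p\<close>, and \<open>a\<close> minimal with \<open>p\<^sup>a m > n\<close>; conversely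
  every such pair \<open>(p, m)\<close> occurs. The pairs with \<open>m\<close> equal to 1 or prime account for the binomial
  coefficient. If \<open>m\<close> is composite, then it is odd and \<open>p\<^sup>2 < m \<le> n\<close>, so the excess is at most
  \<open>\<pi>(\<surd>n)\<close> times the number of odd composites up to \<open>n\<close>, which is at most \<open>n / 2\<close> and is 0 for
  \<open>n < 9\<close>.

  The last equivalence is the prime number theorem. It is obtained by Newman's contour argument for
  the series \<open>\<Sum>n. (\<psi>(n) - n) / n\<^sup>2\<close>, whose convergence forces \<open>\<psi>(n) \<sim> n\<close> because \<open>\<psi>\<close> is monotone.
\<close>

section \<open>Newman's Tauberian theorem\<close>

text \<open>The Dirichlet series are available for \<open>Re s > 1\<close> only, whereas the contour
  argument needs a holomorphic function on a neighbourhood of the closed half plane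
  \<open>Re w \<ge> 0\<close>. Abel summation writes the series of \<open>mangoldt\<close> as the
  sum of \<psi>(n) (n^(-s) - (n+1)^(-s)). With s = 1 + w the bracket differs from (1 + w) n^(-2-w)
  by \<open>zterm n (2 + w)\<close>, which is O(n^(-3 - Re w)); the Chebyshev bound \<psi>(n) = O(n)
  therefore makes the total difference holomorphic for \<open>Re w > -1\<close>. What remains is the
  logarithmic derivative of zeta, regular on the boundary line away from its pole because zeta has
  no zeros there, and the pole at w = 0 cancels against that of \<zeta>(1 + w), the series belonging
  to the subtracted n. The same terms without the weights \<psi>(n) continue (s - 1) \<zeta>(s) to
  \<open>Re s > 0\<close>.\<close>

lemma powr_diff_mvt:
  fixes x v :: real
  assumes "x > 0"
  obtains \<xi> where "x < \<xi>" "\<xi> < x + 1" "(x + 1) powr v - x powr v = v * \<xi> powr (v - 1)"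
proof -
  have "\<exists>z. x < z \<and> z < x + 1 \<and> (x + 1) powr v - x powr v = (x + 1 - x) * (v * z powr (v - 1))"
    using assms by (intro MVT2) (auto intro!: derivative_eq_intros)
  with that show thesis by auto
qed

text \<open>Each term is compared with an increment of \<open>x powr v / v\<close> through the mean
  value theorem. For \<open>v \<le> 1\<close> the derivative is nonincreasing and the term at the
  right end of a unit interval fits below the increment; for \<open>v > 1\<close> it is the term at
  the left end, so the last term is left over and appears as the extra summand.\<close>

lemma sum_powr_le:
  fixes v :: real
  assumes "v > 0" "N \<ge> 1"
  shows "(\<Sum>n=1..N. real n powr (v - 1)) \<le> real N powr v / v + real N powr (v - 1)"
proof (cases "v \<le> 1")
  case True
  have "(\<Sum>n=1..N. real n powr (v - 1)) \<le> real N powr v / v"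
    using assms(2)
  proof (induction N rule: dec_induct)
    case base
    show ?case using True assms by simp
  next
    case (step N)
    obtain \<xi> where \<xi>: "real N < \<xi>" "\<xi> < real N + 1"
        "(real N + 1) powr v - real N powr v = v * \<xi> powr (v - 1)"
      using powr_diff_mvt[of "real N" v] step by auto
    have "(real N + 1) powr (v - 1) \<le> \<xi> powr (v - 1)"
      using \<xi> True step by (intro powr_mono2') auto
    then have "v * (real N + 1) powr (v - 1) \<le> (real N + 1) powr v - real N powr v"
      using \<xi>(3) assms by simp
    then have "(real N + 1) powr (v - 1) \<le> (real N + 1) powr v / v - real N powr v / v"
      using assms by (simp add: field_simps)
    then show ?case
      using step by (simp add: algebra_simps)
  qed
  then show ?thesis by (smt (verit) powr_ge_zero)
next
  case False
  show ?thesis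
    using assms(2)
  proof (induction N rule: dec_induct)
    case base
    show ?case using False assms by simp
  next
    case (step N)
    obtain \<xi> where \<xi>: "real N < \<xi>" "\<xi> < real N + 1"
        "(real N + 1) powr v - real N powr v = v * \<xi> powr (v - 1)"
      using powr_diff_mvt[of "real N" v] step by auto
    have "real N powr (v - 1) \<le> \<xi> powr (v - 1)"
      using \<xi> False step by (intro powr_mono2) auto
    then have "v * real N powr (v - 1) \<le> (real N + 1) powr v - real N powr v"
      using \<xi>(3) assms by simp
    then have "real N powr (v - 1) \<le> (real N + 1) powr v / v - real N powr v / v"
      using assms by (simp add: field_simps)
    then show ?case
      using step by (simp add: algebra_simps)
  qed
qed

lemma sum_powr_tail_le:
  fixes u :: real
  assumes "u > 0" "N \<ge> 1" "N \<le> M"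
  shows "(\<Sum>n\<in>{N<..M}. real n powr (- 1 - u)) \<le> real N powr (- u) / u"
proof -
  \<comment> \<open>The term at \<open>M\<close> makes the induction telescope; dropping it
    afterwards leaves a bound uniform in \<open>M\<close>, fit for the infinite tail.\<close>
  have "(\<Sum>n\<in>{N<..M}. real n powr (- 1 - u)) \<le> real N powr (- u) / u - real M powr (- u) / u"
    using assms(3)
  proof (induction M rule: dec_induct)
    case base
    show ?case by simp
  next
    case (step M)
    obtain \<xi> where \<xi>: "real M < \<xi>" "\<xi> < real M + 1"
        "(real M + 1) powr (-u) - real M powr (-u) = (-u) * \<xi> powr (- u - 1)"
      using powr_diff_mvt[of "real M" "-u"] step assms by auto
    have "(real M + 1) powr (- u - 1) \<le> \<xi> powr (- u - 1)"
      using \<xi> step assms by (intro powr_mono2') auto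
    then have "(real M + 1) powr (- 1 - u) \<le> \<xi> powr (- u - 1)"
      by (metis (no_types) diff_conv_add_uminus add.commute)
    then have "u * (real M + 1) powr (- 1 - u) \<le> u * \<xi> powr (- u - 1)"
      using assms by (intro mult_left_mono) auto
    then have "u * (real M + 1) powr (- 1 - u) \<le> real M powr (-u) - (real M + 1) powr (-u)"
      using \<xi>(3) by simp
    then have *: "(real M + 1) powr (- 1 - u) \<le> real M powr (-u) / u - (real M + 1) powr (-u) / u"
      using assms by (simp add: field_simps)
    have "{N<..Suc M} = insert (Suc M) {N<..M}" using step by auto
    with * step show ?case by (simp add: algebra_simps)
  qed
  then show ?thesis using assms by (smt (verit) divide_nonneg_pos powr_ge_zero)
qed

section \<open>Norms, arcs and the kernel on the contour\<close>

lemma norm_nat_powr: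
  assumes "n > 0"
  shows "norm (of_nat n powr s :: complex) = real n powr Re s"
  using assms norm_powr_real_powr[of "of_nat n" s] by simp

text \<open>\<open>circlepath\<close> starts at angle 0, so the right half circle falls into two
  quarter arcs and the circle is cut in three. Parametrised by the angle, all four integrals have
  the same integrand.\<close>

lemma circlepath_arcs:
  fixes f :: "complex \<Rightarrow> complex"
  assumes "(f has_contour_integral I) (circlepath c r)"
    and "(f has_contour_integral I1) (part_circlepath c r 0 (pi / 2))"
    and "(f has_contour_integral I2) (part_circlepath c r (pi / 2) (3 * pi / 2))"
    and "(f has_contour_integral I3) (part_circlepath c r (3 * pi / 2) (2 * pi))"
  shows "I = I1 + I2 + I3"
proof -
  define g where "g = (\<lambda>t. f (c + r * cis t) * r * \<i> * cis t)"
  have 0: "(g has_integral I) {0..2*pi}"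
    using assms(1) unfolding circlepath_def g_def by (subst (asm) has_contour_integral_part_circlepath_iff) auto
  have 1: "(g has_integral I1) {0..pi/2}"
    using assms(2) unfolding g_def by (subst (asm) has_contour_integral_part_circlepath_iff) auto
  have 2: "(g has_integral I2) {pi/2..3*pi/2}"
    using assms(3) unfolding g_def by (subst (asm) has_contour_integral_part_circlepath_iff) auto
  have 3: "(g has_integral I3) {3*pi/2..2*pi}"
    using assms(4) unfolding g_def by (subst (asm) has_contour_integral_part_circlepath_iff) auto
  have "(g has_integral (I1 + I2)) {0..3*pi/2}"
    by (rule has_integral_combine[OF _ _ 1 2]) auto
  then have "(g has_integral (I1 + I2 + I3)) {0..2*pi}"
    by (rule has_integral_combine[OF _ _ _ 3, rotated 2]) auto
  with 0 show ?thesis using has_integral_unique by blast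
qed

text \<open>Integrating the decay gains a factor \<open>1 / c\<close> over the length bound. On the
  chords of the contour \<open>c\<close> is \<open>\<delta> * ln (real N)\<close>, so their
  contribution tends to 0 as \<open>N\<close> grows.\<close>

lemma norm_linepath_integral_exp_decay_le:
  fixes f :: "complex \<Rightarrow> complex"
  assumes I: "(f has_contour_integral I) (linepath a b)" and c: "c > 0"
    and le: "\<And>t. 0 \<le> t \<Longrightarrow> t \<le> 1 \<Longrightarrow> norm (f (linepath a b t)) \<le> M * exp (- c * t)"
  shows "norm I \<le> M * norm (b - a) / c"
proof -
  have int: "((\<lambda>t. f (linepath a b t) * (b - a)) has_integral I) {0..1}"
    using I by (simp add: has_contour_integral_linepath)
  have M: "M \<ge> 0" using le[of 0] norm_ge_zero[of "f (linepath a b 0)"] by (smt (verit) exp_zero mult_zero_right mult_cancel_left1)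
  have "((\<lambda>t. exp (- c * t)) has_integral (- exp (- c * 1) / c - (- exp (- c * 0) / c))) {0..1}"
    using c by (intro fundamental_theorem_of_calculus)
      (auto intro!: derivative_eq_intros simp flip: has_real_derivative_iff_has_vector_derivative)
  then have int2: "((\<lambda>t. M * exp (- c * t) * norm (b - a)) has_integral
      (M * (- exp (- c * 1) / c - (- exp (- c * 0) / c)) * norm (b - a))) {0..1}"
    by (intro has_integral_mult_left has_integral_mult_right)
  have "norm I \<le> M * (- exp (- c * 1) / c - (- exp (- c * 0) / c)) * norm (b - a)"
    unfolding has_integral_unique[OF int integrable_integral[OF has_integral_integrable[OF int]]]
    by (rule integral_norm_bound_integral[OF has_integral_integrable[OF int] has_integral_integrable[OF int2],
          unfolded integral_unique[OF int2]])
       (use le in \<open>auto simp: norm_mult intro!: mult_right_mono\<close>)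
  also have "\<dots> \<le> M * (1 / c) * norm (b - a)"
    using c M by (intro mult_right_mono mult_left_mono) (auto simp: field_simps)
  finally show ?thesis by simp
qed

text \<open>On the circle \<open>1 / w = cnj w / R^2\<close>, so Newman's kernel is the real number
  \<open>2 * Re w / R^2\<close>. Its factor \<open>Re w\<close> cancels the
  \<open>1 / \<bar>Re w\<bar>\<close> in the estimates of Dirichlet tails and partial sums.\<close>

lemma newman_kernel_norm:
  assumes "norm w = R" "R > 0"
  shows "norm ((1 + w\<^sup>2 / (of_real R)\<^sup>2) / w) = 2 * \<bar>Re w\<bar> / R\<^sup>2"
proof -
  have w: "w \<noteq> 0" using assms by auto
  have "w * cnj w = (of_real R)\<^sup>2"
    using assms complex_norm_square[of w] by simp
  then have "(1 + w\<^sup>2 / (of_real R)\<^sup>2) / w = (w + cnj w) / (w * cnj w)"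
    using w assms(2) by (simp add: divide_simps power2_eq_square) (simp add: algebra_simps)
  also have "\<dots> = of_real (2 * Re w / R\<^sup>2)"
    using \<open>w * cnj w = _\<close> by (simp add: complex_add_cnj)
  also have "norm \<dots> = 2 * \<bar>Re w\<bar> / R\<^sup>2"
    by (simp add: abs_mult del: of_real_divide of_real_mult)
  finally show ?thesis .
qed

lemma path_image_arc_right:
  assumes "w \<in> path_image (part_circlepath 0 R 0 (pi / 2)) \<union> path_image (part_circlepath 0 R (3 * pi / 2) (2 * pi))"
    "R > 0"
  shows "norm w = R \<and> Re w \<ge> 0"
proof -
  obtain x where x: "w = of_real R * exp (\<i> * of_real x)"
      "0 \<le> x \<and> x \<le> pi / 2 \<or> 3 * pi / 2 \<le> x \<and> x \<le> 2 * pi"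
    using assms by (auto simp: path_image_part_circlepath)
  have "cos x = cos (2 * pi - x)" by (simp add: cos_diff)
  then have "cos x \<ge> 0"
    using x(2) cos_ge_zero[of x] cos_ge_zero[of "2 * pi - x"] by auto
  then show ?thesis using x(1) assms by (auto simp: norm_mult Re_exp simp flip: cis_conv_exp)
qed

lemma path_image_arc_left:
  assumes "w \<in> path_image (part_circlepath 0 R (pi / 2) (3 * pi / 2))" "R > 0"
  shows "norm w = R \<and> Re w \<le> 0"
proof -
  obtain x where x: "w = of_real R * exp (\<i> * of_real x)" "pi / 2 \<le> x \<and> x \<le> 3 * pi / 2"
    using assms by (auto simp: path_image_part_circlepath)
  have "cos x = - cos (x - pi)" by simp
  then have "cos x \<le> 0"
    using x(2) cos_ge_zero[of "x - pi"] by auto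
  then show ?thesis using x(1) assms
    by (auto simp: norm_mult mult_nonneg_nonpos simp flip: cis_conv_exp)
qed

text \<open>The exponent is shifted by 1 so that bounded coefficients give convergence for
  \<open>Re w > 0\<close>, while the value at 0 is the partial sum of \<open>a n / n\<close> whose
  limit is sought.\<close>

definition dirichlet_sum :: "(nat \<Rightarrow> complex) \<Rightarrow> nat \<Rightarrow> complex \<Rightarrow> complex" where
  "dirichlet_sum a N w = (\<Sum>n=1..N. a n * of_nat n powr (- 1 - w))"

context
  fixes a :: "nat \<Rightarrow> complex" and B :: real
  assumes bound: "\<And>n. norm (a n) \<le> B"
begin

lemma coeff_bound_nonneg: "B \<ge> 0"
  using bound[of 0] norm_ge_zero[of "a 0"] by linarith

lemma dirichlet_tail_le:
  assumes "Re w > 0" "N \<ge> 1" and sums: "(\<lambda>n. a n * of_nat n powr (- 1 - w)) sums F"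
  shows "norm (dirichlet_sum a N w - F) \<le> B * (real N powr (- Re w) / Re w)"
proof -
  have "(\<lambda>M. \<Sum>n<M. a n * of_nat n powr (- 1 - w)) \<longlonglongrightarrow> F"
    using sums by (simp add: sums_def)
  then have "(\<lambda>M. \<Sum>n<Suc M. a n * of_nat n powr (- 1 - w)) \<longlonglongrightarrow> F"
    by (rule LIMSEQ_Suc)
  moreover have "(\<Sum>n<Suc M. a n * of_nat n powr (- 1 - w)) = dirichlet_sum a M w" for M
    unfolding dirichlet_sum_def by (intro sum.mono_neutral_cong_right) auto
  ultimately have lim: "(\<lambda>M. dirichlet_sum a N w - dirichlet_sum a M w) \<longlonglongrightarrow> dirichlet_sum a N w - F"
    by (intro tendsto_intros) simp
  show ?thesis
  proof (rule tendsto_upperbound[OF tendsto_norm[OF lim]])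
    show "\<forall>\<^sub>F M in sequentially. norm (dirichlet_sum a N w - dirichlet_sum a M w) \<le> B * (real N powr (- Re w) / Re w)"
      using eventually_ge_at_top[of N]
    proof eventually_elim
      case (elim M)
      have "{1..M} = {1..N} \<union> {N<..M}" using elim assms by auto
      then have "dirichlet_sum a M w = dirichlet_sum a N w + (\<Sum>n\<in>{N<..M}. a n * of_nat n powr (- 1 - w))"
        unfolding dirichlet_sum_def by (simp only:) (rule sum.union_disjoint, auto)
      then have "norm (dirichlet_sum a N w - dirichlet_sum a M w) = norm (\<Sum>n\<in>{N<..M}. a n * of_nat n powr (- 1 - w))"
        by simp
      also have "\<dots> \<le> (\<Sum>n\<in>{N<..M}. B * real n powr (- 1 - Re w))"
        using bound by (intro sum_norm_le) (auto simp: norm_mult norm_nat_powr intro!: mult_right_mono)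
      also have "\<dots> \<le> B * (real N powr (- Re w) / Re w)"
        unfolding sum_distrib_left[symmetric]
        using coeff_bound_nonneg sum_powr_tail_le[OF assms(1,2) elim] by (intro mult_left_mono)
      finally show ?case .
    qed
  qed simp
qed

lemma dirichlet_partial_sum_le:
  assumes "Re w < 0" "N \<ge> 1"
  shows "norm (dirichlet_sum a N w) \<le> B * (real N powr (- Re w) / \<bar>Re w\<bar> + real N powr (- Re w - 1))"
proof -
  have "norm (dirichlet_sum a N w) \<le> (\<Sum>n=1..N. B * real n powr (- Re w - 1))"
    unfolding dirichlet_sum_def using bound
    by (intro sum_norm_le) (auto simp: norm_mult norm_nat_powr minus_diff_commute intro!: mult_mono)
  also have "\<dots> \<le> B * (real N powr (- Re w) / (- Re w) + real N powr (- Re w - 1))"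
    unfolding sum_distrib_left[symmetric]
    using coeff_bound_nonneg sum_powr_le[of "- Re w" N] assms by (intro mult_left_mono) auto
  finally show ?thesis using assms by simp
qed

text \<open>The partial sums are entire and are integrated over the whole circle of radius \<open>R\<close>; \<open>F\<close> is
  integrated over the right half circle closed by two chords through \<open>-\<delta>\<close>, where the factor
  \<open>N\<^sup>w\<close> decays. With the normalisation \<open>F 0 = 0\<close> that second integrand has no pole.\<close>

lemma newman_estimate:
  fixes F :: "complex \<Rightarrow> complex" and R \<delta> :: real
  defines "U \<equiv> {w. norm w < R + 1 \<and> Re w > - 2 * \<delta>}"
  assumes R: "R > 0" and \<delta>: "0 < \<delta>" "\<delta> < 1" and holF: "F holomorphic_on U" and F0: "F 0 = 0"
    and sums: "\<And>w. Re w > 0 \<Longrightarrow> (\<lambda>n. a n * of_nat n powr (- 1 - w)) sums F w"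
  obtains C where "\<And>N. N \<ge> 2 \<Longrightarrow> norm (\<Sum>n=1..N. a n / of_nat n) \<le> 2 * B / R + B / real N + C / ln (real N)"
proof -
  have U_eq: "U = ball 0 (R + 1) \<inter> {w. Re w > - 2 * \<delta>}"
    by (auto simp: U_def)
  have openU: "open U" unfolding U_eq by (intro open_Int open_halfspace_Re_gt) auto
  have convU: "convex U" unfolding U_eq by (intro convex_Int convex_halfspace_Re_gt) auto
  \<comment> \<open>\<open>F1\<close> is \<open>F w / w\<close> with the singularity at 0 removed,
    so \<open>h\<close> is \<open>F\<close> times the kernel, already free of the pole.\<close>
  define F1 where "F1 = (\<lambda>z. if z = 0 then deriv F 0 else (F z - F 0) / (z - 0))"
  have holF1: "F1 holomorphic_on U" unfolding F1_def by (rule pole_lemma_open[OF holF openU])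
  have F_eq: "F w = w * F1 w" for w using F0 by (simp add: F1_def)
  define h where "h = (\<lambda>w. F1 w * (1 + w\<^sup>2 / (of_real R)\<^sup>2))"
  have holh: "h holomorphic_on U" unfolding h_def using R by (intro holomorphic_intros holF1) auto
  define p where "p = \<i> * complex_of_real R"
  \<comment> \<open>The corner lies at depth \<open>\<delta>\<close> while \<open>U\<close> reaches
    depth \<open>2 * \<delta>\<close>: both chords from the ends of the imaginary diameter to
    \<open>q\<close> stay in the open convex set \<open>U\<close>, and \<open>h\<close> has a bound
    on them that does not depend on \<open>N\<close>.\<close>
  define q where "q = - complex_of_real \<delta>"
  have inU: "p \<in> U" "- p \<in> U" "q \<in> U"
    using R \<delta> by (auto simp: U_def p_def q_def norm_mult)
  have seg: "closed_segment p q \<subseteq> U" "closed_segment (-p) q \<subseteq> U"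
    using inU convU by (simp_all add: closed_segment_subset)
  have "compact (h ` (closed_segment p q \<union> closed_segment (-p) q))"
    using seg by (intro compact_continuous_image compact_Un compact_segment
        continuous_on_subset[OF holomorphic_on_imp_continuous_on[OF holh]]) auto
  then obtain M where M: "\<And>w. w \<in> closed_segment p q \<union> closed_segment (-p) q \<Longrightarrow> norm (h w) \<le> M"
    by (meson compact_imp_bounded bounded_iff imageI)
  define D where "D = norm (q - p)"
  have D': "norm (q - (-p)) = D" unfolding D_def p_def q_def by (simp add: cmod_def)
  show thesis
  \<comment> \<open>Each of the two chords costs at most
    \<open>M * D / (\<delta> * ln (real N))\<close>; division by the \<open>2 * pi\<close> of
    Cauchy's formula gives this constant.\<close>
  proof (rule that[of "M * D / (\<delta> * pi)"])
    fix N :: nat assume N: "N \<ge> 2"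
    then have lnN: "ln (real N) > 0" by simp
    define f where "f = (\<lambda>w. h w * of_nat N powr w)"
    have holf: "f holomorphic_on U" unfolding f_def by (intro holomorphic_intros holh)
    \<comment> \<open>A primitive on the convex set \<open>U\<close> turns every integral of
      \<open>f\<close> into a difference of values of \<open>G\<close>, so the detour through
      \<open>q\<close> is an identity between such differences.\<close>
    obtain G where G: "\<And>x. x \<in> U \<Longrightarrow> (G has_field_derivative f x) (at x within U)"
      using holomorphic_convex_primitive'[OF convU openU holf] by blast
    have arcU: "path_image (part_circlepath 0 R 0 (pi / 2)) \<subseteq> U"
        "path_image (part_circlepath 0 R (3 * pi / 2) (2 * pi)) \<subseteq> U"
      using path_image_arc_right[OF _ R] \<delta> unfolding U_def by fastforce+
    have [simp]: "cos (3 * pi / 2) = 0" "sin (3 * pi / 2) = - 1"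
      using cos_3over2_pi sin_3over2_pi by simp_all
    have R_exp: "of_real R * exp (\<i> * of_real (pi / 2)) = p" "of_real R * exp (\<i> * of_real (3 * pi / 2)) = - p"
      "of_real R * exp (\<i> * of_real (2 * pi)) = of_real R"
      by (auto simp: p_def complex_eq_iff Re_exp Im_exp)
    have i1: "(f has_contour_integral (G p - G (of_real R))) (part_circlepath 0 R 0 (pi / 2))"
      using contour_integral_primitive[OF G _ arcU(1)] R_exp by simp
    have i3: "(f has_contour_integral (G (of_real R) - G (- p))) (part_circlepath 0 R (3 * pi / 2) (2 * pi))"
      using contour_integral_primitive[OF G valid_path_part_circlepath arcU(2)]
      unfolding pathstart_part_circlepath pathfinish_part_circlepath R_exp add_0_left .
    have l1: "(f has_contour_integral (G q - G p)) (linepath p q)"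
      using contour_integral_primitive[OF G, of "linepath p q"] seg by simp
    have l2: "(f has_contour_integral (G q - G (-p))) (linepath (-p) q)"
      using contour_integral_primitive[OF G, of "linepath (-p) q"] seg by simp
    have "norm (G q - G p) \<le> M * norm (q - p) / (\<delta> * ln (real N))"
    proof (rule norm_linepath_integral_exp_decay_le[OF l1])
      fix t :: real assume t: "0 \<le> t" "t \<le> 1"
      then have "linepath p q t \<in> closed_segment p q" by (auto simp: linepath_in_path)
      moreover have "Re (linepath p q t) = - \<delta> * t" by (simp add: linepath_def p_def q_def)
      ultimately show "norm (f (linepath p q t)) \<le> M * exp (- (\<delta> * ln (real N)) * t)"
        unfolding f_def norm_mult using N M
        by (intro mult_mono) (auto simp: norm_nat_powr powr_def mult_ac intro: order_trans[OF norm_ge_zero])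
    qed (use \<delta> lnN in simp)
    moreover have "norm (G q - G (-p)) \<le> M * norm (q - (-p)) / (\<delta> * ln (real N))"
    proof (rule norm_linepath_integral_exp_decay_le[OF l2])
      fix t :: real assume t: "0 \<le> t" "t \<le> 1"
      then have "linepath (-p) q t \<in> closed_segment (-p) q" by (auto simp: linepath_in_path)
      moreover have "Re (linepath (-p) q t) = - \<delta> * t" by (simp add: linepath_def p_def q_def)
      ultimately show "norm (f (linepath (-p) q t)) \<le> M * exp (- (\<delta> * ln (real N)) * t)"
        unfolding f_def norm_mult using N M
        by (intro mult_mono) (auto simp: norm_nat_powr powr_def mult_ac intro: order_trans[OF norm_ge_zero])
    qed (use \<delta> lnN in simp)
    moreover have "norm (G p - G (-p)) \<le> norm (G q - G (-p)) + norm (G q - G p)"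
      using norm_triangle_ineq4[of "G q - G (-p)" "G q - G p"] by simp
    ultimately have Gp: "norm (G p - G (-p)) \<le> 2 * (M * D / (\<delta> * ln (real N)))"
      unfolding D_def[symmetric] D' mult_2 by (meson add_mono order_trans)

    \<comment> \<open>The numerator for Cauchy's formula at 0: there the last two factors are 1, so
      \<open>s 0\<close> is the sum of \<open>a n / n\<close> up to \<open>N\<close>.\<close>
    define s where "s = (\<lambda>w. dirichlet_sum a N w * of_nat N powr w * (1 + w\<^sup>2 / (of_real R)\<^sup>2))"
    have hols: "s holomorphic_on A" for A
      unfolding s_def dirichlet_sum_def using R by (intro holomorphic_intros) auto
    have circ: "((\<lambda>w. s w / (w - 0)) has_contour_integral (2 * of_real pi * \<i> * s 0)) (circlepath 0 R)"
      using R hols by (intro Cauchy_integral_circlepath_simple) auto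
    have intble: "(\<lambda>w. s w / (w - 0)) contour_integrable_on part_circlepath 0 R x y" if "x \<le> y" for x y
    proof -
      have "path_image (part_circlepath 0 R x y) \<subseteq> - {0}"
        using R that by (auto simp: path_image_part_circlepath)
      then show ?thesis using R
        by (intro contour_integrable_holomorphic_simple[of _ "- {0}"] holomorphic_intros hols) auto
    qed
    have ord: "0 \<le> pi / 2" "pi / 2 \<le> 3 * pi / 2" "3 * pi / 2 \<le> 2 * pi" by auto
    obtain J1 J2 J3 where
        J1: "((\<lambda>w. s w / (w - 0)) has_contour_integral J1) (part_circlepath 0 R 0 (pi / 2))"
      and J2: "((\<lambda>w. s w / (w - 0)) has_contour_integral J2) (part_circlepath 0 R (pi / 2) (3 * pi / 2))"
      and J3: "((\<lambda>w. s w / (w - 0)) has_contour_integral J3) (part_circlepath 0 R (3 * pi / 2) (2 * pi))"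
      using intble[OF ord(1)] intble[OF ord(2)] intble[OF ord(3)] unfolding contour_integrable_on_def by blast
    have split: "2 * of_real pi * \<i> * s 0 = J1 + J2 + J3"
      by (rule circlepath_arcs[OF circ J1 J2 J3])

    have right: "norm (s w / (w - 0) - f w) \<le> 2 * B / R\<^sup>2" if w: "norm w = R" "Re w \<ge> 0" for w
    proof -
      have w0: "w \<noteq> 0" using w R by auto
      have "s w / (w - 0) - f w = (dirichlet_sum a N w - F w) * of_nat N powr w * ((1 + w\<^sup>2 / (of_real R)\<^sup>2) / w)"
        using w0 by (simp add: s_def f_def h_def F_eq field_simps)
      then have eq: "norm (s w / (w - 0) - f w) = norm (dirichlet_sum a N w - F w) * real N powr Re w * (2 * Re w / R\<^sup>2)"
        using newman_kernel_norm[OF w(1) R] w N by (simp add: norm_mult norm_nat_powr del: times_divide_eq_right)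
      show ?thesis
      proof (cases "Re w = 0")
        case True
        then show ?thesis using eq coeff_bound_nonneg by simp
      next
        case False
        then have u: "Re w > 0" using w by simp
        have "norm (dirichlet_sum a N w - F w) * real N powr Re w * (2 * Re w / R\<^sup>2)
            \<le> B * (real N powr (- Re w) / Re w) * real N powr Re w * (2 * Re w / R\<^sup>2)"
          using u N by (intro mult_right_mono dirichlet_tail_le[OF u _ sums[OF u]]) auto
        also have "\<dots> = 2 * B / R\<^sup>2"
          using u N by (simp add: powr_minus field_simps)
        finally show ?thesis using eq by simp
      qed
    qed
    have left: "norm (s w / (w - 0)) \<le> 2 * B / R\<^sup>2 + 2 * B / (R * N)" if w: "norm w = R" "Re w \<le> 0" for w
    proof -
      have w0: "w \<noteq> 0" using w R by auto
      have "s w / (w - 0) = dirichlet_sum a N w * of_nat N powr w * ((1 + w\<^sup>2 / (of_real R)\<^sup>2) / w)"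
        using w0 by (simp add: s_def)
      then have eq: "norm (s w / (w - 0)) = norm (dirichlet_sum a N w) * real N powr Re w * (2 * \<bar>Re w\<bar> / R\<^sup>2)"
        using newman_kernel_norm[OF w(1) R] w N
        by (simp only: norm_mult norm_nat_powr abs_of_nonneg)
      show ?thesis
      proof (cases "Re w = 0")
        case True
        then show ?thesis using eq coeff_bound_nonneg R w0 by auto
      next
        case False
        then have u: "Re w < 0" using w by simp
        have "norm (dirichlet_sum a N w) * real N powr Re w * (2 * \<bar>Re w\<bar> / R\<^sup>2)
            \<le> B * (real N powr (- Re w) / \<bar>Re w\<bar> + real N powr (- Re w - 1)) * real N powr Re w * (2 * \<bar>Re w\<bar> / R\<^sup>2)"
          using u N by (intro mult_right_mono dirichlet_partial_sum_le[OF u])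
              (auto intro: divide_nonpos_nonneg)
        also have "\<dots> = 2 * B / R\<^sup>2 + 2 * B * (\<bar>Re w\<bar> / (R\<^sup>2 * N))"
          using u N R by (simp add: powr_minus powr_diff field_simps)
        also have "\<bar>Re w\<bar> / (R\<^sup>2 * N) \<le> R / (R\<^sup>2 * N)"
          using abs_Re_le_cmod[of w] w by (intro divide_right_mono) auto
        finally show ?thesis using eq coeff_bound_nonneg R by (simp add: power2_eq_square mult_left_mono)
      qed
    qed
    have b1: "norm (J1 - (G p - G (of_real R))) \<le> 2 * B / R\<^sup>2 * R * (pi / 2 - 0)"
      using right path_image_arc_right[OF UnI1 R] coeff_bound_nonneg R
      by (intro has_contour_integral_bound_part_circlepath[OF has_contour_integral_diff[OF J1 i1]]) auto
    have b3: "norm (J3 - (G (of_real R) - G (- p))) \<le> 2 * B / R\<^sup>2 * R * (2 * pi - 3 * pi / 2)"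
      using right path_image_arc_right[OF UnI2 R] coeff_bound_nonneg R
      by (intro has_contour_integral_bound_part_circlepath[OF has_contour_integral_diff[OF J3 i3]]) auto
    have b2: "norm J2 \<le> (2 * B / R\<^sup>2 + 2 * B / (R * N)) * R * (3 * pi / 2 - pi / 2)"
      using left path_image_arc_left[OF _ R] coeff_bound_nonneg R
      by (intro has_contour_integral_bound_part_circlepath[OF J2]) auto
    \<comment> \<open>On the right arcs \<open>f\<close> is subtracted from the integrand; what this
      removes is \<open>G p - G (- p)\<close>, which the chords bound. The left arc involves the
      partial sum alone.\<close>
    have "2 * of_real pi * \<i> * s 0 = (J1 - (G p - G (of_real R))) + J2 + (J3 - (G (of_real R) - G (- p))) + (G p - G (-p))"
      using split by simp
    then have "norm (2 * of_real pi * \<i> * s 0) \<le>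
        norm (J1 - (G p - G (of_real R))) + norm J2 + norm (J3 - (G (of_real R) - G (- p))) + norm (G p - G (-p))"
      by (metis (no_types, lifting) norm_triangle_mono norm_triangle_ineq order_refl)
    also have "\<dots> \<le> 2 * B / R\<^sup>2 * R * (pi / 2 - 0) + (2 * B / R\<^sup>2 + 2 * B / (R * N)) * R * (3 * pi / 2 - pi / 2)
        + 2 * B / R\<^sup>2 * R * (2 * pi - 3 * pi / 2) + 2 * (M * D / (\<delta> * ln (real N)))"
      using b1 b2 b3 Gp by linarith
    also have "\<dots> = 2 * pi * (2 * B / R + B / real N + M * D / (\<delta> * pi) / ln (real N))"
      using R N \<delta> lnN by (simp add: field_simps power2_eq_square)
    finally have "norm (s 0) \<le> 2 * B / R + B / real N + M * D / (\<delta> * pi) / ln (real N)"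
      by (simp add: norm_mult)
    moreover have "s 0 = (\<Sum>n=1..N. a n / of_nat n)"
      unfolding s_def dirichlet_sum_def by (auto simp: powr_minus divide_simps intro!: sum.cong)
    ultimately show "norm (\<Sum>n=1..N. a n / of_nat n) \<le> 2 * B / R + B / real N + M * D / (\<delta> * pi) / ln (real N)"
      by simp
  qed
qed

end

text \<open>Changing only the coefficient at 1 subtracts the constant \<open>F 0\<close> from the
  series at every \<open>w\<close>, which arranges the normalisation of
  \<open>newman_estimate\<close>. There \<open>N\<close> tends to infinity for fixed
  \<open>R\<close>, and \<open>R\<close> is chosen by the tolerance.\<close>

theorem newman:
  fixes a :: "nat \<Rightarrow> complex" and F :: "complex \<Rightarrow> complex"
  assumes bound: "\<And>n. norm (a n) \<le> B"
    and \<Omega>: "open \<Omega>" "{w. Re w \<ge> 0} \<subseteq> \<Omega>" "F holomorphic_on \<Omega>"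
    and sums: "\<And>w. Re w > 0 \<Longrightarrow> (\<lambda>n. a n * of_nat n powr (- 1 - w)) sums F w"
  shows "(\<lambda>N. \<Sum>n=1..N. a n / of_nat n) \<longlonglongrightarrow> F 0"
proof -
  define a' where "a' = (\<lambda>n. a n - (if n = 1 then F 0 else 0))"
  define B' where "B' = B + norm (F 0)"
  have bound': "norm (a' n) \<le> B'" for n
  proof (cases "n = 1")
    case True
    then show ?thesis
      using bound[of 1] norm_triangle_ineq4[of "a 1" "F 0"] by (simp add: a'_def B'_def)
  next
    case False
    then show ?thesis
      using bound[of n] by (simp add: a'_def B'_def add_increasing2)
  qed
  have B': "B' \<ge> 0" using bound'[of 0] norm_ge_zero[of "a' 0"] by linarith
  have sums': "(\<lambda>n. a' n * of_nat n powr (- 1 - w)) sums (F w - F 0)" if "Re w > 0" for w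
  proof -
    have "(\<lambda>n. if n = 1 then F 0 else 0) sums F 0" by (rule sums_single)
    moreover have "a' n * of_nat n powr (- 1 - w) = a n * of_nat n powr (- 1 - w) - (if n = 1 then F 0 else 0)" for n
      by (simp add: a'_def algebra_simps)
    ultimately show ?thesis using sums_diff[OF sums[OF that]] by simp
  qed
  have sum_a': "(\<Sum>n=1..N. a' n / of_nat n) = (\<Sum>n=1..N. a n / of_nat n) - F 0" if "N \<ge> 1" for N
  proof -
    have "(\<Sum>n=1..N. a' n / of_nat n) = (\<Sum>n=1..N. a n / of_nat n - (if n = 1 then F 0 else 0))"
      by (intro sum.cong) (auto simp: a'_def)
    also have "\<dots> = (\<Sum>n=1..N. a n / of_nat n) - F 0"
      using that by (simp add: sum_subtractf)
    finally show ?thesis .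
  qed
  have "\<forall>\<^sub>F N in sequentially. norm ((\<Sum>n=1..N. a n / of_nat n) - F 0) < \<epsilon>" if \<epsilon>: "\<epsilon> > 0" for \<epsilon>
  proof -
    \<comment> \<open>Large enough for \<open>2 * B' / R < \<epsilon>\<close>; the summand 1 keeps
      \<open>R\<close> positive when \<open>B' = 0\<close>.\<close>
    define R where "R = 4 * B' / \<epsilon> + 1"
    have R: "R > 0" using B' \<epsilon> by (auto simp: R_def intro!: add_nonneg_pos)
    have "2 * B' / R < \<epsilon>"
      using \<epsilon> B' R by (simp add: R_def field_simps) (intro add_pos_nonneg; simp)
    \<comment> \<open>Holomorphy left of the imaginary axis comes without a uniform width.
      Compactness at bounded height provides one, so \<open>\<delta>\<close> depends on
      \<open>R\<close>.\<close>
    have "compact (cball 0 (R + 1) \<inter> {w. Re w \<ge> 0})"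
      by (intro compact_Int_closed closed_halfspace_Re_ge) auto
    then obtain e where e: "e > 0" "(\<Union>x\<in>cball 0 (R + 1) \<inter> {w. Re w \<ge> 0}. ball x e) \<subseteq> \<Omega>"
      using compact_subset_open_imp_ball_epsilon_subset[OF _ \<Omega>(1)] \<Omega>(2) by (metis Int_subset_iff Int_lower2 subset_trans)
    define \<delta> where "\<delta> = min (1 / 2) (e / 2)"
    have \<delta>: "0 < \<delta>" "\<delta> < 1" "2 * \<delta> \<le> e" using e by (auto simp: \<delta>_def)
    have "{w. norm w < R + 1 \<and> Re w > - 2 * \<delta>} \<subseteq> \<Omega>"
    proof
      fix w assume "w \<in> {w. norm w < R + 1 \<and> Re w > - 2 * \<delta>}"
      then have w: "norm w < R + 1" "Re w > - 2 * \<delta>" by auto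
      show "w \<in> \<Omega>"
      proof (cases "Re w \<ge> 0")
        case True
        then show ?thesis using \<Omega>(2) by auto
      next
        case False
        define x where "x = \<i> * of_real (Im w)"
        have "norm x \<le> R + 1" using abs_Im_le_cmod[of w] w by (simp add: x_def norm_mult)
        moreover have "x - w = - of_real (Re w)" by (simp add: x_def complex_eq_iff)
        then have "dist x w < e" using w False \<delta> by (simp add: dist_norm)
        moreover have "Re x = 0" by (simp add: x_def)
        ultimately show ?thesis using e(2) by (intro subsetD[OF e(2)] UN_I[of x]) auto
      qed
    qed
    then have hol: "(\<lambda>w. F w - F 0) holomorphic_on {w. norm w < R + 1 \<and> Re w > - 2 * \<delta>}"
      using \<Omega>(3) holomorphic_on_subset by (intro holomorphic_intros) blast
    obtain C where C: "\<And>N. N \<ge> 2 \<Longrightarrow> norm (\<Sum>n=1..N. a' n / of_nat n) \<le> 2 * B' / R + B' / real N + C / ln (real N)"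
      using newman_estimate[OF bound' R \<delta>(1,2) hol _ sums'] by auto
    have "(\<lambda>N. 2 * B' / R + B' / real N + C / ln (real N)) \<longlonglongrightarrow> 2 * B' / R + 0 + 0"
      by (intro tendsto_add tendsto_const; real_asymp)
    then have "\<forall>\<^sub>F N in sequentially. 2 * B' / R + B' / real N + C / ln (real N) < \<epsilon>"
      by (rule order_tendstoD) (use \<open>2 * B' / R < \<epsilon>\<close> in simp)
    then show ?thesis using eventually_ge_at_top[of 2]
    proof eventually_elim
      case (elim N)
      then show ?case using C[of N] sum_a'[of N] by simp
    qed
  qed
  then show ?thesis by (simp add: tendsto_iff dist_norm)
qed

section \<open>Chebyshev bounds\<close>

definition chebyshev_psi :: "nat \<Rightarrow> real" where
  "chebyshev_psi n = (\<Sum>d=1..n. mangoldt d)"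

lemma chebyshev_psi_0 [simp]: "chebyshev_psi 0 = 0"
  by (simp add: chebyshev_psi_def)

lemma chebyshev_psi_Suc: "chebyshev_psi (Suc n) = chebyshev_psi n + mangoldt (Suc n)"
  by (simp add: chebyshev_psi_def)

lemma chebyshev_psi_nonneg: "chebyshev_psi n \<ge> 0"
  unfolding chebyshev_psi_def by (intro sum_nonneg mangoldt_nonneg)

lemma chebyshev_psi_mono: "m \<le> n \<Longrightarrow> chebyshev_psi m \<le> chebyshev_psi n"
  unfolding chebyshev_psi_def by (intro sum_mono2 mangoldt_nonneg) auto

text \<open>Legendre's formula, by exchanging the summations in ln k as the sum of
  \<open>mangoldt\<close> over the divisors of k. The free upper limit \<open>M\<close> lets the
  formulas for \<open>n\<close> and \<open>2 * n\<close> be subtracted over one common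
  range.\<close>

lemma ln_fact_mangoldt:
  assumes "n \<le> M"
  shows "ln (fact n) = (\<Sum>d=1..M. mangoldt d * real (n div d))"
proof -
  have "ln (fact n :: real) = ln (\<Prod>k=1..n. real k)"
    by (simp add: fact_prod)
  also have "\<dots> = (\<Sum>k=1..n. ln (real k))"
    by (rule ln_prod) auto
  also have "\<dots> = (\<Sum>k=1..n. \<Sum>d=1..M. if d dvd k then mangoldt d else 0)"
  proof (rule sum.cong)
    fix k assume k: "k \<in> {1..n}"
    have "ln (real k) = (\<Sum>d | d dvd k. mangoldt d)"
      using mangoldt_sum[of k, where ?'a = real] k by simp
    also have "\<dots> = (\<Sum>d=1..M. if d dvd k then mangoldt d else 0)"
    proof (intro sum.mono_neutral_cong_left)
      show "{d. d dvd k} \<subseteq> {1..M}"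
        using k assms dvd_imp_le[of _ k] dvd_pos_nat[of k] by (force simp: Suc_le_eq)
    qed auto
    finally show "ln (real k) = \<dots>" .
  qed simp
  also have "\<dots> = (\<Sum>d=1..M. \<Sum>k=1..n. if d dvd k then mangoldt d else 0)"
    by (rule sum.swap)
  also have "\<dots> = (\<Sum>d=1..M. mangoldt d * real (n div d))"
  proof (rule sum.cong)
    fix d assume d: "d \<in> {1..M}"
    have "{k\<in>{1..n}. d dvd k} = (\<lambda>j. d * j) ` {1..n div d}"
    proof (intro equalityI subsetI)
      fix k assume "k \<in> {k\<in>{1..n}. d dvd k}"
      then obtain j where "k = d * j" "1 \<le> d * j" "d * j \<le> n" by (auto elim: dvdE)
      then show "k \<in> (*) d ` {1..n div d}"
        using d by (auto simp: less_eq_div_iff_mult_less_eq mult.commute Suc_le_eq)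
    next
      fix k assume "k \<in> (*) d ` {1..n div d}"
      then show "k \<in> {k\<in>{1..n}. d dvd k}"
        using d by (auto simp: less_eq_div_iff_mult_less_eq mult.commute Suc_le_eq)
    qed
    then have "card {k\<in>{1..n}. d dvd k} = n div d"
      using d by (simp add: card_image inj_on_def)
    moreover have "(\<Sum>k=1..n. if d dvd k then mangoldt d else (0::real)) = real (card {k\<in>{1..n}. d dvd k}) * mangoldt d"
      by (subst sum.inter_filter[symmetric]) auto
    ultimately show "(\<Sum>k=1..n. if d dvd k then mangoldt d else 0) = mangoldt d * real (n div d)"
      by simp
  qed simp
  finally show ?thesis .
qed

text \<open>The coefficient \<open>2 * n div d - 2 * (n div d)\<close> is never negative and equals
  1 for \<open>n < d \<le> 2 * n\<close>, so the difference is at most the logarithm of the central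
  binomial coefficient.\<close>

lemma chebyshev_psi_double_le: "chebyshev_psi (2 * n) - chebyshev_psi n \<le> 2 * ln 2 * real n"
proof -
  have "{1..2*n} = {1..n} \<union> {n<..2*n}" by auto
  then have "chebyshev_psi (2 * n) - chebyshev_psi n = (\<Sum>d\<in>{n<..2*n}. mangoldt d)"
    unfolding chebyshev_psi_def by (simp only:) (subst sum.union_disjoint, auto)
  also have "\<dots> = (\<Sum>d\<in>{n<..2*n}. mangoldt d * (real (2 * n div d) - 2 * real (n div d)))"
  proof (rule sum.cong)
    fix d assume d: "d \<in> {n<..2*n}"
    then have "2 * n div d = 1" by (intro div_nat_eqI) auto
    with d show "mangoldt d = mangoldt d * (real (2 * n div d) - 2 * real (n div d))" by simp
  qed simp
  also have "\<dots> \<le> (\<Sum>d=1..2*n. mangoldt d * (real (2 * n div d) - 2 * real (n div d)))"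
  proof (intro sum_mono2 mult_nonneg_nonneg mangoldt_nonneg)
    fix d :: nat
    have "2 * (n div d) \<le> 2 * n div d"
      by (cases "d = 0") (auto simp: less_eq_div_iff_mult_less_eq mult.assoc)
    then show "0 \<le> real (2 * n div d) - 2 * real (n div d)" by linarith
  qed auto
  also have "\<dots> = ln (fact (2 * n)) - 2 * ln (fact n)"
    using ln_fact_mangoldt[of "2 * n" "2 * n"] ln_fact_mangoldt[of n "2 * n"]
    by (simp add: right_diff_distrib sum_subtractf sum_distrib_left mult_ac)
  also have "\<dots> = ln (fact (2 * n) / (fact n * fact n))"
    by (simp add: ln_div ln_mult)
  also have "fact (2 * n) / (fact n * fact n) = real (2 * n choose n)"
    using binomial_fact[of n "2 * n", where ?'a = real] by simp
  also have "ln (real (2 * n choose n)) \<le> ln (2 ^ (2 * n))"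
    using of_nat_mono[OF binomial_le_pow2[of "2 * n" n], where ?'a = real]
    by (subst ln_le_cancel_iff) auto
  also have "\<dots> = 2 * ln 2 * real n" by (simp add: ln_realpow)
  finally show ?thesis .
qed

text \<open>Doubling costs \<open>2 * ln 2 * k \<le> 2 * k\<close>, which turns \<open>4 * k\<close>
  into \<open>6 * k\<close>. The slack up to \<open>8 * k\<close> pays for the one further term, at
  most \<open>n - 1 = 2 * k\<close>, of an odd \<open>n\<close>; hence the generous constant
  4.\<close>

lemma chebyshev_psi_le: "chebyshev_psi n \<le> 4 * real n"
proof (induction n rule: less_induct)
  case (less n)
  consider "n = 0" | "n = 1" | k where "n = 2 * k" "k > 0" | k where "n = Suc (2 * k)" "k > 0"
    by (metis One_nat_def evenE mult_0_right not_gr_zero oddE Suc_eq_plus1)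
  then show ?case
  proof cases
    case 1
    then show ?thesis by simp
  next
    case 2
    then show ?thesis by (simp add: chebyshev_psi_def)
  next
    case (3 k)
    have "chebyshev_psi k \<le> 4 * real k" using less 3 by simp
    moreover have "2 * ln 2 * real k \<le> 2 * real k"
      using mult_right_mono[OF order_trans[OF ln2_le_25_over_36, of 1], of "real k"] by simp
    ultimately show ?thesis using chebyshev_psi_double_le[of k] unfolding 3 of_nat_mult of_nat_numeral by linarith
  next
    case (4 k)
    have "chebyshev_psi k \<le> 4 * real k" using less 4 by simp
    moreover have "2 * ln 2 * real k \<le> 2 * real k"
      using mult_right_mono[OF order_trans[OF ln2_le_25_over_36, of 1], of "real k"] by simp
    ultimately have "chebyshev_psi (2 * k) \<le> 6 * real k"
      using chebyshev_psi_double_le[of k] by linarith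
    moreover have "mangoldt n \<le> real n - 1"
      using mangoldt_le[of n] ln_le_minus_one[of "real n"] 4 by simp
    ultimately show ?thesis by (simp add: 4 chebyshev_psi_Suc)
  qed
qed

text \<open>These terms sum to \<open>(s - 1) \<zeta>(s) - 1\<close>: the powers with exponent \<open>1 - s\<close> telescope to \<open>-1\<close> for
  \<open>Re s > 1\<close>, and their presence makes the series converge for \<open>Re s > 0\<close>.\<close>

definition zterm :: "nat \<Rightarrow> complex \<Rightarrow> complex" where
  "zterm n s = (s - 1) * of_nat n powr (- s) - of_nat n powr (1 - s) + of_nat (Suc n) powr (1 - s)"

text \<open>\<open>zterm n s\<close> is the remainder at \<open>n + 1\<close> of the linear Taylor
  polynomial of \<open>z powr (1 - s)\<close> about \<open>n\<close>, hence controlled by the second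
  derivative \<open>(1 - s) * (- s) * z powr (- s - 1)\<close>.\<close>

lemma norm_zterm_le:
  assumes "n > 0" "Re s > 0"
  shows "norm (zterm n s) \<le> norm s * norm (s - 1) * real n powr (- Re s - 1)"
proof -
  define f where "f = (\<lambda>i::nat. \<lambda>z::complex. if i = 0 then z powr (1 - s)
      else if i = 1 then (1 - s) * z powr (- s) else (1 - s) * ((- s) * z powr (- s - 1)))"
  define a b where "a = complex_of_nat n" and "b = complex_of_nat (Suc n)"
  have pos: "z \<in> \<real> \<and> Re z \<ge> real n" if z: "z \<in> closed_segment a b" for z
  proof -
    obtain u where u: "0 \<le> u" "u \<le> 1" "z = (1 - u) *\<^sub>R a + u *\<^sub>R b"
      using z unfolding in_segment by blast
    then have "z = of_real (real n + u)" by (simp add: a_def b_def scaleR_conv_of_real algebra_simps)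
    then show ?thesis using u by simp
  qed
  have nonpos: "z \<notin> \<real>\<^sub>\<le>\<^sub>0" if "z \<in> closed_segment a b" for z
    using pos[OF that] assms by (auto simp: complex_nonpos_Reals_iff)
  have "norm (f 0 b - (\<Sum>i\<le>1. f i a * (b - a) ^ i / fact i))
      \<le> (norm s * norm (s - 1) * real n powr (- Re s - 1)) * norm (b - a) ^ Suc 1 / fact 1"
  proof (rule complex_Taylor[of "closed_segment a b"])
    fix i z assume z: "z \<in> closed_segment a b" and i: "i \<le> (1::nat)"
    consider "i = 0" | "i = 1" using i by linarith
    then show "(f i has_field_derivative f (Suc i) z) (at z within closed_segment a b)"
    proof cases
      case 1
      have "((\<lambda>z. z powr (1 - s)) has_field_derivative (1 - s) * z powr (1 - s - 1)) (at z)"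
        by (rule has_field_derivative_powr[OF nonpos[OF z]])
      then show ?thesis using 1 by (auto simp: f_def intro: DERIV_subset)
    next
      case 2
      have "((\<lambda>z. (1 - s) * z powr (- s)) has_field_derivative (1 - s) * ((- s) * z powr (- s - 1))) (at z)"
        by (intro DERIV_cmult has_field_derivative_powr[OF nonpos[OF z]])
      then show ?thesis using 2 by (auto simp: f_def intro: DERIV_subset)
    qed
  next
    fix z assume z: "z \<in> closed_segment a b"
    have "norm (z powr (- s - 1)) = Re z powr (- Re s - 1)"
      using pos[OF z] assms by (subst norm_powr_real_powr) auto
    also have "\<dots> \<le> real n powr (- Re s - 1)"
      using pos[OF z] assms by (intro powr_mono2') auto
    finally have "norm (z powr (- s - 1)) \<le> real n powr (- Re s - 1)" .
    then show "norm (f (Suc 1) z) \<le> norm s * norm (s - 1) * real n powr (- Re s - 1)"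
      by (auto simp: f_def norm_mult norm_minus_commute mult_ac intro!: mult_left_mono)
  qed auto
  moreover have "f 0 b - (\<Sum>i\<le>1. f i a * (b - a) ^ i / fact i) = zterm n s"
    by (simp add: f_def a_def b_def zterm_def algebra_simps)
  moreover have "norm (b - a) = 1" by (simp add: a_def b_def)
  ultimately show ?thesis by simp
qed

lemma holomorphic_on_zterm [holomorphic_intros]:
  assumes "f holomorphic_on A"
  shows "(\<lambda>z. zterm n (f z)) holomorphic_on A"
  unfolding zterm_def by (intro holomorphic_intros assms)

text \<open>Weighted sums of the functions \<^term>\<open>zterm n\<close> cover both the continuation of zeta and the
  comparison of \<open>\<Sum>\<^sub>n \<psi>(n) n\<^bsup>-2-w\<^esup>\<close> with the logarithmic derivative of zeta.\<close>

lemma zterm_series: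
  fixes c :: "nat \<Rightarrow> complex"
  assumes c: "\<And>n. n > 0 \<Longrightarrow> norm (c n) \<le> B * real n powr k" and k: "k \<ge> 0"
  defines "A \<equiv> {s. Re s > k}"
  shows "\<And>s. s \<in> A \<Longrightarrow> summable (\<lambda>n. c (Suc n) * zterm (Suc n) s)"
    and "(\<lambda>s. suminf (\<lambda>n. c (Suc n) * zterm (Suc n) s)) holomorphic_on A"
proof -
  have B: "B \<ge> 0" using order_trans[OF norm_ge_zero c[of 1]] by simp
  have bd: "\<exists>d>0. cball s d \<subseteq> A \<and> (\<exists>M. summable M \<and> (\<forall>n. \<forall>z\<in>cball s d. norm (c (Suc n) * zterm (Suc n) z) \<le> M n))"
    if s: "s \<in> A" for s
  proof -
    \<comment> \<open>Half the distance to the boundary: on the disc of this radius the terms are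
      O(n^(-1-d)), which serves both summability and locally uniform convergence.\<close>
    define d where "d = (Re s - k) / 2"
    have d: "d > 0" using s by (simp add: d_def A_def)
    define K where "K = norm s + d"
    define M where "M = (\<lambda>n. B * real (Suc n) powr k * (K * (K + 1) * real (Suc n) powr (- (k + d) - 1)))"
    have z: "Re z \<ge> k + d" "norm z \<le> K" "norm (z - 1) \<le> K + 1" if "z \<in> cball s d" for z
    proof -
      have "Re s - Re z \<le> d" using that abs_Re_le_cmod[of "s - z"] by (simp add: dist_norm)
      then show "Re z \<ge> k + d" by (simp add: d_def field_simps)
      show "norm z \<le> K" using that norm_triangle_ineq2[of z s] by (simp add: dist_norm K_def norm_minus_commute)
      then show "norm (z - 1) \<le> K + 1" using norm_triangle_ineq4[of z 1] by simp
    qed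
    have "norm (c (Suc n) * zterm (Suc n) z) \<le> M n" if "z \<in> cball s d" for n z
    proof -
      have "norm (zterm (Suc n) z) \<le> norm z * norm (z - 1) * real (Suc n) powr (- Re z - 1)"
        using z[OF that] d k by (intro norm_zterm_le) auto
      also have "\<dots> \<le> K * (K + 1) * real (Suc n) powr (- (k + d) - 1)"
        using z[OF that] d by (intro mult_mono powr_mono) (auto simp: K_def)
      finally show ?thesis unfolding norm_mult M_def using c[of "Suc n"] B by (intro mult_mono) auto
    qed
    moreover have "M = (\<lambda>n. B * K * (K + 1) * real (Suc n) powr (- d - 1))"
    proof
      fix n
      have "M n = B * K * (K + 1) * (real (Suc n) powr k * real (Suc n) powr (- (k + d) - 1))"
        by (simp only: M_def mult_ac)
      also have "real (Suc n) powr k * real (Suc n) powr (- (k + d) - 1) = real (Suc n) powr (- d - 1)"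
        by (simp only: powr_add[symmetric]) simp
      finally show "M n = B * K * (K + 1) * real (Suc n) powr (- d - 1)" .
    qed
    moreover have "summable (\<lambda>n. B * K * (K + 1) * real (Suc n) powr (- d - 1))"
      using d summable_Suc_iff[of "\<lambda>n. real n powr (- d - 1)"] summable_real_powr_iff[of "- d - 1"]
      by (intro summable_mult) auto
    moreover have "cball s d \<subseteq> A" using z(1) d by (fastforce simp: A_def)
    ultimately show ?thesis using d by metis
  qed
  show "summable (\<lambda>n. c (Suc n) * zterm (Suc n) s)" if s: "s \<in> A" for s
  proof -
    obtain d M where "d > 0" "summable M" "\<forall>n. \<forall>z\<in>cball s d. norm (c (Suc n) * zterm (Suc n) z) \<le> M n"
      using bd[OF s] by auto
    then show ?thesis by - (rule summable_comparison_test'[of M 0], auto)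
  qed
  show "(\<lambda>s. suminf (\<lambda>n. c (Suc n) * zterm (Suc n) s)) holomorphic_on A"
  proof (rule holomorphic_uniform_sequence[where f = "\<lambda>N s. \<Sum>n<N. c (Suc n) * zterm (Suc n) s"])
    show "open A" unfolding A_def by (rule open_halfspace_Re_gt)
    show "(\<lambda>s. \<Sum>n<N. c (Suc n) * zterm (Suc n) s) holomorphic_on A" for N
      by (intro holomorphic_intros)
    fix s assume "s \<in> A"
    from bd[OF this] obtain d M where d: "d > 0" "cball s d \<subseteq> A" and M: "summable M" "\<forall>n. \<forall>z\<in>cball s d. norm (c (Suc n) * zterm (Suc n) z) \<le> M n"
      by auto
    then have "uniform_limit (cball s d) (\<lambda>N s. \<Sum>n<N. c (Suc n) * zterm (Suc n) s)
        (\<lambda>s. suminf (\<lambda>n. c (Suc n) * zterm (Suc n) s)) sequentially"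
      by (intro Weierstrass_m_test) auto
    with d show "\<exists>d>0. cball s d \<subseteq> A \<and> uniform_limit (cball s d) (\<lambda>N s. \<Sum>n<N. c (Suc n) * zterm (Suc n) s)
        (\<lambda>s. suminf (\<lambda>n. c (Suc n) * zterm (Suc n) s)) sequentially" by blast
  qed
qed

section \<open>The zeta function\<close>

text \<open>Half of the excess \<open>\<sigma> - 1\<close> pays for the logarithm; the other half
  keeps the exponent below -1.\<close>

lemma summable_ln_powr:
  assumes "\<sigma> > 1"
  shows "summable (\<lambda>n. ln (real n) * real n powr (- \<sigma>))"
proof (rule summable_comparison_test'[of "\<lambda>n. real n powr (- ((1 + \<sigma>) / 2)) / ((\<sigma> - 1) / 2)" 1])
  show "summable (\<lambda>n. real n powr (- ((1 + \<sigma>) / 2)) / ((\<sigma> - 1) / 2))"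
    using assms by (intro summable_divide) (simp add: summable_real_powr_iff)
  fix n :: nat assume n: "n \<ge> 1"
  have "ln (real n) * real n powr (- \<sigma>) \<le> (real n powr ((\<sigma> - 1) / 2) / ((\<sigma> - 1) / 2)) * real n powr (- \<sigma>)"
    using n assms by (intro mult_right_mono ln_powr_bound) auto
  also have "\<dots> = real n powr ((\<sigma> - 1) / 2 + (- \<sigma>)) / ((\<sigma> - 1) / 2)"
    by (simp only: powr_add) simp
  also have "(\<sigma> - 1) / 2 + (- \<sigma>) = - ((1 + \<sigma>) / 2)" by (simp add: field_simps)
  finally show "norm (ln (real n) * real n powr (- \<sigma>)) \<le> real n powr (- ((1 + \<sigma>) / 2)) / ((\<sigma> - 1) / 2)"
    using n by simp
qed

lemma summable_mangoldt_powr: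
  assumes "\<sigma> > 1"
  shows "summable (\<lambda>n. mangoldt n * real n powr (- \<sigma>))"
proof (rule summable_comparison_test'[OF summable_ln_powr[OF assms], of 1])
  fix n :: nat assume "n \<ge> 1"
  then show "norm (mangoldt n * real n powr (- \<sigma>)) \<le> ln (real n) * real n powr (- \<sigma>)"
    using mangoldt_le[of n] by (simp add: abs_mult mult_right_mono)
qed

section \<open>Dirichlet series in the half plane of absolute convergence\<close>

lemma norm_dirichlet_term: "norm (c * of_nat n powr (- s) :: complex) = norm c * real n powr (- Re s)"
  by (cases "n = 0") (simp_all add: norm_mult norm_nat_powr)

text \<open>The index may start at 0, since \<open>0 powr (- s) = 0\<close>.\<close>

definition zeta_series :: "complex \<Rightarrow> complex" where
  "zeta_series s = suminf (\<lambda>n. of_nat n powr (- s))"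

definition mangoldt_series :: "complex \<Rightarrow> complex" where
  "mangoldt_series s = suminf (\<lambda>n. mangoldt n * of_nat n powr (- s))"

text \<open>The factor s - 1 removes the pole of zeta, so a single function holomorphic on
  \<open>Re s > 0\<close> carries the continuation, the point 1 included.\<close>

definition zeta_reg :: "complex \<Rightarrow> complex" where
  "zeta_reg s = 1 + suminf (\<lambda>n. zterm (Suc n) s)"

context
  fixes s :: complex
  assumes s: "Re s > 1"
begin

lemma abs_summable_zeta: "summable (\<lambda>n. norm (of_nat n powr (- s)))"
  using norm_dirichlet_term[of 1 _ s] s by (simp add: summable_real_powr_iff)

lemma abs_summable_mangoldt: "summable (\<lambda>n. norm (mangoldt n * of_nat n powr (- s)))"
  using summable_mangoldt_powr[OF s] by (simp add: norm_dirichlet_term)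

lemma sums_zeta: "(\<lambda>n. of_nat n powr (- s)) sums zeta_series s"
  unfolding zeta_series_def using abs_summable_zeta by (rule summable_sums[OF summable_norm_cancel])

lemma sums_mangoldt: "(\<lambda>n. mangoldt n * of_nat n powr (- s)) sums mangoldt_series s"
  unfolding mangoldt_series_def using abs_summable_mangoldt by (rule summable_sums[OF summable_norm_cancel])

lemma norm_mangoldt_series_le:
  assumes "1 < \<sigma>" "\<sigma> \<le> Re s"
  shows "norm (mangoldt_series s) \<le> suminf (\<lambda>n. mangoldt n * real n powr (- \<sigma>))"
  unfolding mangoldt_series_def
proof (rule norm_suminf_le[OF _ summable_mangoldt_powr[OF assms(1)]])
  fix n
  have "real n powr (- Re s) \<le> real n powr (- \<sigma>)"
    using assms by (cases "n = 0") (auto intro!: powr_mono)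
  then show "norm (mangoldt n * of_nat n powr (- s) :: complex) \<le> mangoldt n * real n powr (- \<sigma>)"
    unfolding norm_dirichlet_term by (simp add: mult_left_mono mangoldt_nonneg)
qed

lemma zeta_reg_eq: "zeta_reg s = (s - 1) * zeta_series s"
proof -
  have *: "(\<Sum>n<N. zterm (Suc n) s) = (s - 1) * (\<Sum>n<N. of_nat (Suc n) powr (- s)) - 1 + of_nat (Suc N) powr (1 - s)" for N
    by (induction N) (simp_all add: zterm_def algebra_simps)
  have "(\<lambda>N. real (Suc N) powr (1 - Re s)) \<longlonglongrightarrow> 0"
    using s by (intro tendsto_neg_powr filterlim_compose[OF filterlim_real_sequentially filterlim_Suc]) auto
  then have "(\<lambda>N. norm (of_nat (Suc N) powr (1 - s) :: complex)) \<longlonglongrightarrow> 0"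
    by (subst norm_nat_powr) auto
  then have 1: "(\<lambda>N. of_nat (Suc N) powr (1 - s) :: complex) \<longlonglongrightarrow> 0"
    by (rule tendsto_norm_zero_cancel)
  have "(\<lambda>n. of_nat (Suc n) powr (- s)) sums zeta_series s"
    using sums_zeta by (subst sums_Suc_iff) simp
  then have "(\<lambda>N. \<Sum>n<N. zterm (Suc n) s) \<longlonglongrightarrow> (s - 1) * zeta_series s - 1 + 0"
    unfolding * by (intro tendsto_intros 1) (simp add: sums_def)
  then have "(\<lambda>n. zterm (Suc n) s) sums ((s - 1) * zeta_series s - 1)" by (simp add: sums_def)
  then show ?thesis by (simp add: zeta_reg_def sums_iff)
qed

text \<open>The Dirichlet convolution of \<open>mangoldt\<close> with 1 is the logarithm. Absolute
  convergence allows the double series to be regrouped by the product of the indices; index 0 is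
  left out to make \<open>(a, b) \<mapsto> (a * b, a)\<close> a bijection onto the pairs of a
  positive number and a divisor of it.\<close>

lemma sums_ln_eq_product:
  "(\<lambda>n. of_real (ln (real n)) * of_nat n powr (- s)) sums (mangoldt_series s * zeta_series s)"
proof -
  define P :: "(nat \<times> nat) set" where "P = {0<..} \<times> {0<..}"
  define f where "f = (\<lambda>n. mangoldt n * of_nat n powr (- s) :: complex)"
  define g where "g = (\<lambda>n::nat. of_nat n powr (- s) :: complex)"
  have f0: "f 0 = 0" and g0: "g 0 = 0" by (simp_all add: f_def g_def)
  have fs: "(f has_sum mangoldt_series s) {0<..}"
    using norm_summable_imp_has_sum[OF abs_summable_mangoldt sums_mangoldt] f0
    by (subst has_sum_cong_neutral[of UNIV _ f f]) (auto simp: f_def)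
  have gs: "(g has_sum zeta_series s) {0<..}"
    using norm_summable_imp_has_sum[OF abs_summable_zeta sums_zeta] g0
    by (subst has_sum_cong_neutral[of UNIV _ g g]) (auto simp: g_def)
  have abs: "(\<lambda>n. norm (f n)) summable_on {0<..}" "(\<lambda>n. norm (g n)) summable_on {0<..}"
    using norm_summable_imp_summable_on[of "\<lambda>n. norm (f n)"] norm_summable_imp_summable_on[of "\<lambda>n. norm (g n)"]
      abs_summable_mangoldt abs_summable_zeta unfolding f_def g_def
    by (simp_all add: summable_on_subset_banach[of _ UNIV])
  have "(\<lambda>x. norm (case x of (a, b) \<Rightarrow> f a * g b)) summable_on P"
    unfolding P_def
  proof (rule summable_on_SigmaI[where g = "\<lambda>a. norm (f a) * (\<Sum>\<^sub>\<infinity>b\<in>{0<..}. norm (g b))"])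
    show "((\<lambda>b. norm (case (a, b) of (a, b) \<Rightarrow> f a * g b)) has_sum norm (f a) * (\<Sum>\<^sub>\<infinity>b\<in>{0<..}. norm (g b))) {0<..}" for a
      using has_sum_cmult_right[OF has_sum_infsum[OF abs(2)]] by (simp add: norm_mult)
  qed (auto intro: summable_on_cmult_left abs(1))
  then have "(\<lambda>(a, b). f a * g b) summable_on P" by (rule abs_summable_summable)
  then have "((\<lambda>(a, b). f a * g b) has_sum (mangoldt_series s * zeta_series s)) P"
    unfolding P_def using fs gs
    by (intro has_sum_SigmaI[where g = "\<lambda>a. f a * zeta_series s"]) (auto intro!: has_sum_cmult_left has_sum_cmult_right)
  also have "?this \<longleftrightarrow> ((\<lambda>(n, d). mangoldt d * of_nat n powr (- s)) has_sum (mangoldt_series s * zeta_series s))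
      (SIGMA n:{0<..}. {d. d dvd n})"
  proof (rule has_sum_reindex_bij_witness[of _ "\<lambda>(n, d). (d, n div d)" "\<lambda>(a, b). (a * b, a)"])
    fix x assume "x \<in> P"
    then show "(case case x of (a, b) \<Rightarrow> (a * b, a) of (n, d) \<Rightarrow> mangoldt d * of_nat n powr (- s)) = (case x of (a, b) \<Rightarrow> f a * g b)"
      by (auto simp: P_def f_def g_def powr_times_real)
  qed (auto simp: P_def dvd_def)
  finally have "((\<lambda>n. of_real (ln (real n)) * of_nat n powr (- s)) has_sum (mangoldt_series s * zeta_series s)) {0<..}"
  proof (rule has_sum_SigmaD)
    fix n :: nat assume n: "n \<in> {0<..}"
    have "(\<Sum>d | d dvd n. mangoldt d * of_nat n powr (- s)) = of_real (ln (real n)) * of_nat n powr (- s)"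
      using mangoldt_sum[of n, where ?'a = complex] n by (simp flip: sum_distrib_right)
    then show "((\<lambda>d. case (n, d) of (n, d) \<Rightarrow> mangoldt d * of_nat n powr (- s)) has_sum of_real (ln (real n)) * of_nat n powr (- s)) {d. d dvd n}"
      using n by (simp add: has_sum_finite_iff)
  qed
  then have "((\<lambda>n. of_real (ln (real n)) * of_nat n powr (- s)) has_sum (mangoldt_series s * zeta_series s)) UNIV"
    by (subst has_sum_cong_neutral[of "{0<..}"]) auto
  then show ?thesis by (rule has_sum_imp_sums)
qed

text \<open>Termwise differentiation, uniform on a half plane whose edge lies midway between 1 and
  \<open>Re s\<close>; the differentiated series is the negative of the product found in
  \<open>sums_ln_eq_product\<close>.\<close>

lemma zeta_series_has_field_derivative:
  "(zeta_series has_field_derivative (- (mangoldt_series s * zeta_series s))) (at s)"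
proof -
  define c where "c = (1 + Re s) / 2"
  define A where "A = {z. Re z > c}"
  have c: "c > 1" "c < Re s" using s by (auto simp: c_def)
  have A: "open A" "convex A" unfolding A_def by (auto intro: open_halfspace_Re_gt convex_halfspace_Re_gt)
  have "((\<lambda>s. suminf (\<lambda>n. of_nat n powr (- s))) has_field_derivative
      suminf (\<lambda>n. - (of_real (ln (real n)) * of_nat n powr (- s)))) (at s)"
  proof (rule has_field_derivative_series'(2)[OF A(2)])
    show "((\<lambda>s. of_nat n powr (- s)) has_field_derivative - (of_real (ln (real n)) * of_nat n powr (- z))) (at z within A)" for n z
    proof (cases "n = 0")
      case False
      then have "((\<lambda>s. of_nat n powr (- s)) has_field_derivative (Ln (of_nat n) * of_nat n powr (- z)) * (- 1)) (at z within A)"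
        by (intro DERIV_chain2[OF has_field_derivative_powr_right]) (auto intro!: derivative_eq_intros)
      then show ?thesis using False by (simp add: Ln_of_nat)
    qed simp
    show "uniformly_convergent_on A (\<lambda>N z. \<Sum>n<N. - (of_real (ln (real n)) * of_nat n powr (- z) :: complex))"
    proof (rule Weierstrass_m_test'[OF _ summable_ln_powr[OF c(1)]])
      fix n :: nat and z assume "z \<in> A"
      then have "real n powr (- Re z) \<le> real n powr (- c)" unfolding A_def
        by (cases "n = 0") (auto intro!: powr_mono)
      moreover have "ln (real n) \<ge> 0" by (cases "n = 0") auto
      ultimately show "norm (- (of_real (ln (real n)) * of_nat n powr (- z)) :: complex) \<le> ln (real n) * real n powr (- c)"
        unfolding norm_minus_cancel norm_dirichlet_term by (simp add: mult_left_mono)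
    qed
    show "s \<in> A" "s \<in> interior A" using c A by (auto simp: A_def interior_open)
    show "summable (\<lambda>n. of_nat n powr (- s))" using sums_zeta by (rule sums_summable)
  qed
  also have "suminf (\<lambda>n. - (of_real (ln (real n)) * of_nat n powr (- s))) = - (mangoldt_series s * zeta_series s)"
    using sums_minus[OF sums_ln_eq_product] by (simp add: sums_iff)
  finally show ?thesis unfolding zeta_series_def[abs_def] .
qed

end

text \<open>Stated as a product and not as a quotient: that \<open>zeta_reg\<close> has no zeros for
  \<open>Re s > 1\<close> is itself deduced from this identity.\<close>

lemma deriv_zeta_reg:
  assumes s: "Re s > 1"
  shows "deriv zeta_reg s = zeta_reg s * (1 / (s - 1) - mangoldt_series s)"
proof -
  have "((\<lambda>z. (z - 1) * zeta_series z) has_field_derivative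
      (1 * zeta_series s + (- (mangoldt_series s * zeta_series s)) * (s - 1))) (at s)"
    by (rule DERIV_mult[OF _ zeta_series_has_field_derivative[OF s]]) (auto intro!: derivative_eq_intros)
  then have "(zeta_reg has_field_derivative (1 * zeta_series s + (- (mangoldt_series s * zeta_series s)) * (s - 1))) (at s)"
  proof (rule has_field_derivative_transform_within_open)
    show "open {z. Re z > 1}" by (rule open_halfspace_Re_gt)
  qed (use s zeta_reg_eq in auto)
  then have "deriv zeta_reg s = zeta_series s - mangoldt_series s * ((s - 1) * zeta_series s)"
    by (simp add: DERIV_imp_deriv mult_ac)
  also have "\<dots> = zeta_reg s * (1 / (s - 1) - mangoldt_series s)"
  proof -
    have "s \<noteq> 1" using s by auto
    then show ?thesis unfolding zeta_reg_eq[OF s] by (simp add: field_simps)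
  qed
  finally show ?thesis .
qed

lemma holomorphic_zeta_reg: "zeta_reg holomorphic_on {s. Re s > 0}"
  using zterm_series(2)[of "\<lambda>_. 1" 1 0] unfolding zeta_reg_def[abs_def]
  by (intro holomorphic_intros) auto

lemma zeta_reg_1 [simp]: "zeta_reg 1 = 1"
proof -
  have "zterm (Suc n) 1 = 0" for n
    using of_nat_neq_0[of n, where ?'a = complex] of_nat_neq_0[of "Suc n", where ?'a = complex]
    by (simp add: zterm_def del: of_nat_Suc)
  then show ?thesis by (simp add: zeta_reg_def)
qed

section \<open>Nonvanishing on the line \<open>Re s = 1\<close>\<close>

text \<open>With f = g (z - z0)^m and g nonzero near z0, the logarithmic derivative is m / (z - z0)
  plus a regular function. Orders of zeros thus become limits, which inequalities between series can
  control.\<close>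

lemma log_deriv_limit:
  assumes f: "f holomorphic_on S" and S: "open S" "connected S" "z0 \<in> S" and nz: "\<exists>w\<in>S. f w \<noteq> 0"
  obtains m :: nat where "m = 0 \<longleftrightarrow> f z0 \<noteq> 0"
    "((\<lambda>z. (z - z0) * (deriv f z / f z)) \<longlongrightarrow> of_nat m) (at z0)"
proof -
  define m where "m = nat (zorder f z0)"
  define g where "g = zor_poly f z0"
  have *: "if f z0 = 0 then zorder f z0 > 0 else zorder f z0 = 0"
    and "\<exists>r. r>0 \<and> cball z0 r \<subseteq> S \<and> g holomorphic_on cball z0 r
      \<and> (\<forall>w\<in>cball z0 r. f w = g w * (w - z0) ^ m \<and> g w \<noteq> 0)"
    using zorder_exist_zero[OF f S nz] unfolding m_def g_def by blast+
  then obtain r where r: "r > 0" "cball z0 r \<subseteq> S" "g holomorphic_on cball z0 r"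
    and fg: "\<And>w. w \<in> cball z0 r \<Longrightarrow> f w = g w * (w - z0) ^ m" "\<And>w. w \<in> cball z0 r \<Longrightarrow> g w \<noteq> 0"
    by blast
  have hg: "g holomorphic_on ball z0 r" using r(3) by (rule holomorphic_on_subset) auto
  have dg: "(g has_field_derivative deriv g w) (at w)" if "w \<in> ball z0 r" for w
    using hg that by (intro holomorphic_derivI[of _ "ball z0 r"]) auto
  have eq: "(w - z0) * (deriv f w / f w) = of_nat m + (w - z0) * (deriv g w / g w)" if w: "w \<in> ball z0 r - {z0}" for w
  proof -
    have "((\<lambda>w. g w * (w - z0) ^ m) has_field_derivative
        (deriv g w * (w - z0) ^ m + (of_nat m * (w - z0) ^ (m - 1) * 1) * g w)) (at w)"
      using w by (intro DERIV_mult dg) (auto intro!: derivative_eq_intros)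
    then have "(f has_field_derivative (deriv g w * (w - z0) ^ m + (of_nat m * (w - z0) ^ (m - 1) * 1) * g w)) (at w)"
      by (rule has_field_derivative_transform_within_open[where S = "ball z0 r"]) (use w fg in auto)
    then have "deriv f w = deriv g w * (w - z0) ^ m + of_nat m * (w - z0) ^ (m - 1) * g w"
      by (simp add: DERIV_imp_deriv)
    moreover have "f w = g w * (w - z0) ^ m" "g w \<noteq> 0" using fg[of w] w by auto
    moreover define D where "D = w - z0"
    moreover have "D \<noteq> 0" using w by (auto simp: D_def)
    ultimately show ?thesis by (cases m) (simp_all add: divide_simps, simp_all add: algebra_simps)
  qed
  have hg': "deriv g holomorphic_on ball z0 r" by (rule holomorphic_deriv[OF hg open_ball])
  have "isCont (deriv g) z0" "isCont g z0"
    by (rule continuous_on_interior[OF holomorphic_on_imp_continuous_on[OF hg']]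
          continuous_on_interior[OF holomorphic_on_imp_continuous_on[OF hg]]; use r(1) in simp)+
  then have "((\<lambda>w. of_nat m + (w - z0) * (deriv g w / g w)) \<longlongrightarrow> of_nat m + (z0 - z0) * (deriv g z0 / g z0)) (at z0)"
    using fg(2)[of z0] r(1) by (intro tendsto_intros) (auto simp: isCont_def)
  then have "((\<lambda>w. of_nat m + (w - z0) * (deriv g w / g w)) \<longlongrightarrow> of_nat m) (at z0)" by simp
  moreover have "\<forall>\<^sub>F w in at z0. (w - z0) * (deriv f w / f w) = of_nat m + (w - z0) * (deriv g w / g w)"
    by (rule eventually_mono[OF eventually_at_in_open[of "ball z0 r" z0]]) (use r(1) eq in \<open>simp_all\<close>)
  ultimately have "((\<lambda>w. (w - z0) * (deriv f w / f w)) \<longlongrightarrow> of_nat m) (at z0)"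
    by (simp add: tendsto_cong)
  moreover have "m = 0 \<longleftrightarrow> f z0 \<noteq> 0" using * by (auto simp: m_def split: if_splits)
  ultimately show thesis by (intro that[of m])
qed

text \<open>The limit is taken along a horizontal ray from the right because for
  \<open>Re s \<ge> 1\<close> this ray lies where the Dirichlet series converge. The value 1 at the
  point 1 shows that \<open>zeta_reg\<close> is not identically zero.\<close>

lemma zeta_reg_log_deriv_limit:
  assumes "Re s > 0"
  obtains m :: nat where "m = 0 \<longleftrightarrow> zeta_reg s \<noteq> 0"
    "((\<lambda>x. of_real x * (deriv zeta_reg (s + of_real x) / zeta_reg (s + of_real x))) \<longlongrightarrow> of_nat m) (at_right 0)"
proof -
  have nz: "\<exists>w\<in>{s. Re s > 0}. zeta_reg w \<noteq> 0"
    by (intro bexI[of _ 1]) auto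
  have "s \<in> {s. Re s > 0}" using assms by simp
  then obtain m :: nat where m: "m = 0 \<longleftrightarrow> zeta_reg s \<noteq> 0"
      "((\<lambda>z. (z - s) * (deriv zeta_reg z / zeta_reg z)) \<longlongrightarrow> of_nat m) (at s)"
    by (rule log_deriv_limit[OF holomorphic_zeta_reg open_halfspace_Re_gt
          convex_connected[OF convex_halfspace_Re_gt] _ nz])
  have "((\<lambda>x. s + of_real x) \<longlongrightarrow> s + of_real 0) (at_right 0)"
    by (intro tendsto_intros)
  then have "filterlim (\<lambda>x. s + of_real x) (at s) (at_right 0)"
    by (auto simp: filterlim_at eventually_at_filter)
  from filterlim_compose[OF m(2) this] m(1) show thesis
    by (intro that[of m]) auto
qed

text \<open>A zero would make the logarithmic derivative blow up, but to the right of
  \<open>s\<close> it is bounded by an absolutely convergent series; this argument stands in for the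
  Euler product.\<close>

lemma zeta_reg_nonzero_of_gt_1:
  assumes s: "Re s > 1"
  shows "zeta_reg s \<noteq> 0"
proof -
  obtain m :: nat where m: "m = 0 \<longleftrightarrow> zeta_reg s \<noteq> 0"
    "((\<lambda>x. of_real x * (deriv zeta_reg (s + of_real x) / zeta_reg (s + of_real x))) \<longlongrightarrow> of_nat m) (at_right 0)"
    by (rule zeta_reg_log_deriv_limit[of s]) (use s in simp)
  define C where "C = suminf (\<lambda>n. mangoldt n * real n powr (- Re s))"
  have "((\<lambda>x. of_real x * (deriv zeta_reg (s + of_real x) / zeta_reg (s + of_real x))) \<longlongrightarrow> 0) (at_right 0)"
  proof (rule Lim_null_comparison)
    show "\<forall>\<^sub>F x in at_right 0. norm (of_real x * (deriv zeta_reg (s + of_real x) / zeta_reg (s + of_real x)))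
        \<le> x * (1 / (Re s - 1) + C)"
      unfolding eventually_at_right_field
    proof (intro exI[of _ 1] conjI allI impI)
      fix x :: real assume x: "0 < x" "x < 1"
      define z where "z = s + of_real x"
      have z: "Re z > 1" "Re s \<le> Re z" using s x by (auto simp: z_def)
      have L: "norm (mangoldt_series z) \<le> C"
        unfolding C_def by (rule norm_mangoldt_series_le[OF z(1) s z(2)])
      have "Re s - 1 \<le> norm (z - 1)" using complex_Re_le_cmod[of "z - 1"] z by simp
      then have "norm (1 / (z - 1)) \<le> 1 / (Re s - 1)" using s by (simp add: norm_divide frac_le)
      \<comment> \<open>At a zero of \<open>zeta_reg\<close> the quotient is 0 by the convention for
        division, so the bound holds there as well.\<close>
      then have "norm (deriv zeta_reg z / zeta_reg z) \<le> 1 / (Re s - 1) + C"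
        unfolding deriv_zeta_reg[OF z(1)] using L norm_triangle_ineq4[of "1 / (z - 1)" "mangoldt_series z"]
          s order_trans[OF norm_ge_zero L]
        by (cases "zeta_reg z = 0") auto
      then show "norm (of_real x * (deriv zeta_reg (s + of_real x) / zeta_reg (s + of_real x))) \<le> x * (1 / (Re s - 1) + C)"
        using x unfolding norm_mult z_def[symmetric] by (simp add: mult_left_mono)
    qed simp
    show "((\<lambda>x. x * (1 / (Re s - 1) + C)) \<longlongrightarrow> 0) (at_right 0)"
      by (rule tendsto_eq_intros | simp)+
  qed
  then have "of_nat m = (0::complex)" using m(2) by (intro tendsto_unique[OF _ m(2)]) auto
  then show ?thesis using m(1) by simp
qed

lemma mangoldt_series_eq:
  assumes "Re s > 1"
  shows "mangoldt_series s = 1 / (s - 1) - deriv zeta_reg s / zeta_reg s"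
  using deriv_zeta_reg[OF assms] zeta_reg_nonzero_of_gt_1[OF assms] by simp

text \<open>Termwise this is 3 + 4 cos \<theta> + cos 2\<theta> = 2 (1 + cos \<theta>)^2 with
  \<theta> = t ln n, weighted by nonnegative coefficients.\<close>

lemma mangoldt_series_341:
  assumes "x > 0"
  shows "Re (3 * mangoldt_series (1 + of_real x) + 4 * mangoldt_series (1 + \<i> * of_real t + of_real x)
    + mangoldt_series (1 + \<i> * of_real (2 * t) + of_real x)) \<ge> 0"
proof -
  have sums: "(\<lambda>n. mangoldt n * (real n powr (- (1 + x)) * cos (u * ln (real n)))) sums Re (mangoldt_series (1 + \<i> * of_real u + of_real x))" for u
  proof -
    have "Re (mangoldt n * of_nat n powr (- (1 + \<i> * of_real u + of_real x))) = mangoldt n * (real n powr (- (1 + x)) * cos (u * ln (real n)))" for n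
    proof (cases "n = 0")
      case False
      then have "of_nat n powr (- (1 + \<i> * of_real u + of_real x)) = exp (of_real (- (1 + x) * ln (real n)) + \<i> * of_real (- (u * ln (real n))))"
        by (simp add: powr_def Ln_of_nat algebra_simps)
      then have "Re (of_nat n powr (- (1 + \<i> * of_real u + of_real x))) = real n powr (- (1 + x)) * cos (u * ln (real n))"
        using False by (simp add: Re_exp powr_def)
      moreover have "Re (mangoldt n * of_nat n powr (- (1 + \<i> * of_real u + of_real x))) = mangoldt n * Re (of_nat n powr (- (1 + \<i> * of_real u + of_real x)))"
        by simp
      ultimately show ?thesis by metis
    qed simp
    moreover have "Re (1 + \<i> * of_real u + of_real x) > 1" using assms by simp
    ultimately show ?thesis
      using sums_Re[OF sums_mangoldt] by (metis (no_types, lifting) sums_cong)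
  qed
  have total: "(\<lambda>n. 3 * (mangoldt n * (real n powr (- (1 + x)) * cos (0 * ln (real n))))
      + 4 * (mangoldt n * (real n powr (- (1 + x)) * cos (t * ln (real n))))
      + mangoldt n * (real n powr (- (1 + x)) * cos (2 * t * ln (real n))))
    sums (3 * Re (mangoldt_series (1 + \<i> * of_real 0 + of_real x))
      + 4 * Re (mangoldt_series (1 + \<i> * of_real t + of_real x))
      + Re (mangoldt_series (1 + \<i> * of_real (2 * t) + of_real x)))"
    by (intro sums_add sums_mult sums)
  have nonneg: "3 * (mangoldt n * (real n powr (- (1 + x)) * cos (0 * ln (real n))))
      + 4 * (mangoldt n * (real n powr (- (1 + x)) * cos (t * ln (real n))))
      + mangoldt n * (real n powr (- (1 + x)) * cos (2 * t * ln (real n))) \<ge> 0" for n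
  proof -
    define \<theta> where "\<theta> = t * ln (real n)"
    have "3 + 4 * cos \<theta> + cos (2 * \<theta>) = 2 * (1 + cos \<theta>)\<^sup>2"
      unfolding cos_double_cos by (simp add: power2_eq_square algebra_simps)
    then have "mangoldt n * real n powr (- (1 + x)) * (3 + 4 * cos \<theta> + cos (2 * \<theta>)) \<ge> 0"
      by (simp add: mangoldt_nonneg)
    then show ?thesis by (simp add: \<theta>_def algebra_simps)
  qed
  have "3 * Re (mangoldt_series (1 + \<i> * of_real 0 + of_real x))
      + 4 * Re (mangoldt_series (1 + \<i> * of_real t + of_real x))
      + Re (mangoldt_series (1 + \<i> * of_real (2 * t) + of_real x)) \<ge> 0"
    by (rule sums_le[OF nonneg sums_zero total])
  then show ?thesis by simp
qed

text \<open>Multiplied by x and let x tend to 0 from the right, the 3-4-1 inequality becomes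
  \<open>3 - 4 * m1 - m2 \<ge> 0\<close> for the orders \<open>m1\<close>, \<open>m2\<close> of the
  zeros at 1 + it and 1 + 2it. As these are natural numbers, \<open>m1 = 0\<close>.\<close>

lemma zeta_reg_nonzero_of_eq_1: "zeta_reg (1 + \<i> * of_real t) \<noteq> 0"
proof (cases "t = 0")
  case False
  \<comment> \<open>The pole part \<open>1 / (s - 1)\<close> contributes 1 at \<open>u = 0\<close>,
    where \<open>m = 0\<close> because \<open>zeta_reg 1 = 1\<close>, and nothing elsewhere.\<close>
  have lim: "\<exists>m::nat. (m = 0 \<longleftrightarrow> zeta_reg (1 + \<i> * of_real u) \<noteq> 0) \<and>
      ((\<lambda>x. of_real x * mangoldt_series (1 + \<i> * of_real u + of_real x)) \<longlongrightarrow> (if u = 0 then 1 else - of_nat m)) (at_right 0)"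
    for u
  proof -
    obtain m :: nat where m: "m = 0 \<longleftrightarrow> zeta_reg (1 + \<i> * of_real u) \<noteq> 0"
      "((\<lambda>x. of_real x * (deriv zeta_reg (1 + \<i> * of_real u + of_real x) / zeta_reg (1 + \<i> * of_real u + of_real x))) \<longlongrightarrow> of_nat m) (at_right 0)"
      by (rule zeta_reg_log_deriv_limit[of "1 + \<i> * of_real u"]) simp
    have 1: "((\<lambda>x. of_real x / (\<i> * of_real u + of_real x)) \<longlongrightarrow> (if u = 0 then 1 else 0 :: complex)) (at_right 0)"
    proof (cases "u = 0")
      case True
      have "\<forall>\<^sub>F x in at_right 0. of_real x / (\<i> * of_real u + of_real x) = (1::complex)"
        using True by (auto simp: eventually_at_filter)
      then show ?thesis using True by (simp add: tendsto_eventually)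
    next
      case False
      have "((\<lambda>x. of_real x / (\<i> * of_real u + of_real x)) \<longlongrightarrow> (of_real 0 / (\<i> * of_real u + of_real 0) :: complex)) (at_right 0)"
        using False by (intro tendsto_intros) auto
      then show ?thesis using False by simp
    qed
    have "((\<lambda>x. of_real x / (\<i> * of_real u + of_real x) -
        of_real x * (deriv zeta_reg (1 + \<i> * of_real u + of_real x) / zeta_reg (1 + \<i> * of_real u + of_real x)))
        \<longlongrightarrow> (if u = 0 then 1 else 0) - of_nat m) (at_right 0)"
      by (rule tendsto_diff[OF 1 m(2)])
    moreover have "\<forall>\<^sub>F x in at_right 0. of_real x / (\<i> * of_real u + of_real x) -
        of_real x * (deriv zeta_reg (1 + \<i> * of_real u + of_real x) / zeta_reg (1 + \<i> * of_real u + of_real x))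
      = of_real x * mangoldt_series (1 + \<i> * of_real u + of_real x)"
      unfolding eventually_at_right_field
      by (intro exI[of _ 1]) (auto simp: mangoldt_series_eq right_diff_distrib)
    ultimately have "((\<lambda>x. of_real x * mangoldt_series (1 + \<i> * of_real u + of_real x)) \<longlongrightarrow> (if u = 0 then 1 else 0) - of_nat m) (at_right 0)"
      by (rule Lim_transform_eventually)
    moreover have "u = 0 \<Longrightarrow> m = 0" using m(1) by simp
    ultimately show ?thesis using m(1) by (intro exI[of _ m]) (cases "u = 0"; simp)
  qed
  obtain m1 :: nat where m1: "m1 = 0 \<longleftrightarrow> zeta_reg (1 + \<i> * of_real t) \<noteq> 0"
      "((\<lambda>x. of_real x * mangoldt_series (1 + \<i> * of_real t + of_real x)) \<longlongrightarrow> - of_nat m1) (at_right 0)"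
    using lim[of t] False by auto
  obtain m2 :: nat where m2:
      "((\<lambda>x. of_real x * mangoldt_series (1 + \<i> * of_real (2 * t) + of_real x)) \<longlongrightarrow> - of_nat m2) (at_right 0)"
    using lim[of "2 * t"] False by auto
  have m0: "((\<lambda>x. of_real x * mangoldt_series (1 + of_real x)) \<longlongrightarrow> 1) (at_right 0)"
    using lim[of 0] by auto
  have "((\<lambda>x. Re (3 * (of_real x * mangoldt_series (1 + of_real x))
      + 4 * (of_real x * mangoldt_series (1 + \<i> * of_real t + of_real x))
      + of_real x * mangoldt_series (1 + \<i> * of_real (2 * t) + of_real x)))
    \<longlongrightarrow> Re (3 * 1 + 4 * (- of_nat m1) + (- of_nat m2))) (at_right 0)"
    by (intro tendsto_Re tendsto_add tendsto_mult tendsto_const m0 m1 m2)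
  moreover have "\<forall>\<^sub>F x in at_right 0. Re (3 * (of_real x * mangoldt_series (1 + of_real x))
      + 4 * (of_real x * mangoldt_series (1 + \<i> * of_real t + of_real x))
      + of_real x * mangoldt_series (1 + \<i> * of_real (2 * t) + of_real x)) \<ge> 0"
    unfolding eventually_at_right_field
  proof (intro exI[of _ 1] conjI allI impI)
    fix x :: real assume x: "0 < x" "x < 1"
    have "0 \<le> x * Re (3 * mangoldt_series (1 + of_real x) + 4 * mangoldt_series (1 + \<i> * of_real t + of_real x)
        + mangoldt_series (1 + \<i> * of_real (2 * t) + of_real x))"
      using mangoldt_series_341[OF x(1), of t] x by (intro mult_nonneg_nonneg) auto
    also have "\<dots> = Re (of_real x * (3 * mangoldt_series (1 + of_real x) + 4 * mangoldt_series (1 + \<i> * of_real t + of_real x)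
        + mangoldt_series (1 + \<i> * of_real (2 * t) + of_real x)))"
      unfolding times_complex.simps by simp
    finally show "0 \<le> Re (3 * (of_real x * mangoldt_series (1 + of_real x))
      + 4 * (of_real x * mangoldt_series (1 + \<i> * of_real t + of_real x))
      + of_real x * mangoldt_series (1 + \<i> * of_real (2 * t) + of_real x))"
      by (simp add: algebra_simps)
  qed simp
  ultimately have "0 \<le> Re (3 * 1 + 4 * (- of_nat m1) + (- of_nat m2))"
    by (rule tendsto_lowerbound) simp
  then have "m1 = 0" by simp
  then show ?thesis using m1(1) by simp
qed simp

lemma zeta_reg_nonzero:
  assumes "Re s \<ge> 1"
  shows "zeta_reg s \<noteq> 0"
proof (cases "Re s = 1")
  case True
  then have "s = 1 + \<i> * of_real (Im s)" by (simp add: complex_eq_iff)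
  then show ?thesis using zeta_reg_nonzero_of_eq_1[of "Im s"] by metis
qed (use assms zeta_reg_nonzero_of_gt_1 in auto)

section \<open>The prime number theorem\<close>

text \<open>The boundary term of the summation by parts is \<open>chebyshev_psi N\<close> times
  \<open>Suc N powr (- s)\<close>, which vanishes in the limit by the linear Chebyshev bound and
  \<open>Re s > 1\<close>.\<close>

lemma sums_chebyshev_psi:
  assumes s: "Re s > 1"
  shows "(\<lambda>n. of_real (chebyshev_psi (Suc n)) * (of_nat (Suc n) powr (- s) - of_nat (Suc (Suc n)) powr (- s)))
    sums mangoldt_series s"
proof -
  have *: "(\<Sum>n<N. of_real (chebyshev_psi (Suc n)) * (of_nat (Suc n) powr (- s) - of_nat (Suc (Suc n)) powr (- s)))
    = (\<Sum>n<N. mangoldt (Suc n) * of_nat (Suc n) powr (- s)) - of_real (chebyshev_psi N) * of_nat (Suc N) powr (- s)" for N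
    by (induction N) (simp_all add: chebyshev_psi_Suc algebra_simps)
  have "(\<lambda>N. of_real (chebyshev_psi N) * of_nat (Suc N) powr (- s) :: complex) \<longlonglongrightarrow> 0"
  proof (rule Lim_null_comparison)
    show "\<forall>\<^sub>F N in sequentially. norm (of_real (chebyshev_psi N) * of_nat (Suc N) powr (- s) :: complex)
        \<le> 4 * real (Suc N) powr (1 - Re s)"
    proof (intro always_eventually allI)
      fix N
      have "norm (of_real (chebyshev_psi N) * of_nat (Suc N) powr (- s) :: complex) = chebyshev_psi N * real (Suc N) powr (- Re s)"
        using chebyshev_psi_nonneg[of N] by (simp only: norm_dirichlet_term norm_of_real abs_of_nonneg)
      also have "\<dots> \<le> (4 * real (Suc N)) * real (Suc N) powr (- Re s)"
        using chebyshev_psi_le[of N] by (intro mult_right_mono) auto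
      also have "\<dots> = 4 * (real (Suc N) powr 1 * real (Suc N) powr (- Re s))" by simp
      also have "real (Suc N) powr 1 * real (Suc N) powr (- Re s) = real (Suc N) powr (1 - Re s)"
        by (simp only: powr_add[symmetric]) simp
      finally show "norm (of_real (chebyshev_psi N) * of_nat (Suc N) powr (- s) :: complex) \<le> 4 * real (Suc N) powr (1 - Re s)" .
    qed
    have "(\<lambda>N. real (Suc N) powr (1 - Re s)) \<longlonglongrightarrow> 0"
      using s by (intro tendsto_neg_powr filterlim_compose[OF filterlim_real_sequentially filterlim_Suc]) auto
    then show "(\<lambda>N. 4 * real (Suc N) powr (1 - Re s)) \<longlonglongrightarrow> 0"
      by (rule tendsto_mult_right_zero)
  qed
  moreover have "(\<lambda>n. mangoldt (Suc n) * of_nat (Suc n) powr (- s)) sums mangoldt_series s"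
    using sums_mangoldt[OF s] by (subst sums_Suc_iff) simp
  ultimately have "(\<lambda>N. \<Sum>n<N. of_real (chebyshev_psi (Suc n)) * (of_nat (Suc n) powr (- s) - of_nat (Suc (Suc n)) powr (- s)))
      \<longlonglongrightarrow> mangoldt_series s - 0"
    unfolding * by (intro tendsto_diff) (simp_all add: sums_def)
  then show ?thesis by (simp add: sums_def)
qed

lemma convergent_psi_series: "convergent (\<lambda>N. \<Sum>n=1..N. (chebyshev_psi n - real n) / (real n)\<^sup>2)"
proof -
  define a :: "nat \<Rightarrow> complex" where "a = (\<lambda>n. of_real ((chebyshev_psi n - real n) / real n))"
  \<comment> \<open>The weights grow at most linearly, so this converges for
    \<open>Re s > 1\<close>; evaluated at \<open>2 + w\<close> it is holomorphic for
    \<open>Re w > -1\<close>.\<close>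
  define H where "H = (\<lambda>s. suminf (\<lambda>n. of_real (chebyshev_psi (Suc n)) * zterm (Suc n) s))"
  have H: "norm (of_real (chebyshev_psi n) :: complex) \<le> 4 * real n powr 1" if "n > 0" for n
    using that chebyshev_psi_le[of n] chebyshev_psi_nonneg[of n] by simp
  have H_sums: "(\<lambda>n. of_real (chebyshev_psi (Suc n)) * zterm (Suc n) s) sums H s" if "Re s > 1" for s
    unfolding H_def using zterm_series(1)[OF H] that by (intro summable_sums) auto
  have H_hol: "H holomorphic_on {s. Re s > 1}"
    unfolding H_def using zterm_series(2)[OF H] by auto
  \<comment> \<open>Only zeros of \<open>zeta_reg\<close> are removed, and none of them has
    \<open>Re w \<ge> 0\<close>; so the closed half plane stays inside.\<close>
  define \<Omega> where "\<Omega> = {w. Re w > -1} \<inter> (\<lambda>w. zeta_reg (1 + w)) -` (- {0})"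
  have "(zeta_reg \<circ> (\<lambda>w. 1 + w)) holomorphic_on {w. Re w > -1}"
    by (rule holomorphic_on_compose_gen[OF _ holomorphic_zeta_reg]) (auto intro!: holomorphic_intros)
  then have hol1: "(\<lambda>w. zeta_reg (1 + w)) holomorphic_on {w. Re w > -1}" by (simp add: o_def)
  have "(deriv zeta_reg \<circ> (\<lambda>w. 1 + w)) holomorphic_on {w. Re w > -1}"
    by (rule holomorphic_on_compose_gen[OF _ holomorphic_deriv[OF holomorphic_zeta_reg open_halfspace_Re_gt]]) (auto intro!: holomorphic_intros)
  then have hol1': "(\<lambda>w. deriv zeta_reg (1 + w)) holomorphic_on {w. Re w > -1}" by (simp add: o_def)
  have "(H \<circ> (\<lambda>w. 2 + w)) holomorphic_on {w. Re w > -1}"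
    by (rule holomorphic_on_compose_gen[OF _ H_hol]) (auto intro!: holomorphic_intros)
  then have hol2: "(\<lambda>w. H (2 + w)) holomorphic_on {w. Re w > -1}" by (simp add: o_def)
  have nz: "1 + w \<noteq> 0" if "Re w > -1" for w
    using that by (auto simp: complex_eq_iff)
  have open\<Omega>: "open \<Omega>" unfolding \<Omega>_def
    by (intro continuous_open_preimage holomorphic_on_imp_continuous_on hol1 open_halfspace_Re_gt) auto
  have sub: "\<Omega> \<subseteq> {w. Re w > -1}" by (auto simp: \<Omega>_def)
  \<comment> \<open>The poles at \<open>w = 0\<close> of the logarithmic derivative and of zeta
    combine to \<open>q w / w\<close>. Both parts of \<open>q\<close> equal 1 at 0, so
    \<open>q 0 = 0\<close> and the quotient extends to \<open>Q\<close>.\<close>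
  define q where "q = (\<lambda>w. 1 / (1 + w) - zeta_reg (1 + w))"
  have holq: "q holomorphic_on {w. Re w > -1}"
    unfolding q_def using nz by (intro holomorphic_intros hol1) auto
  define Q where "Q = (\<lambda>w. if w = 0 then deriv q 0 else (q w - q 0) / (w - 0))"
  have holQ: "Q holomorphic_on {w. Re w > -1}"
    unfolding Q_def by (rule pole_lemma_open[OF holq open_halfspace_Re_gt])
  define F where "F = (\<lambda>w. (H (2 + w) - deriv zeta_reg (1 + w) / zeta_reg (1 + w)) / (1 + w) + Q w)"
  have holF: "F holomorphic_on \<Omega>"
    unfolding F_def using nz
    by (intro holomorphic_intros holomorphic_on_subset[OF hol1 sub] holomorphic_on_subset[OF hol1' sub]
        holomorphic_on_subset[OF hol2 sub] holomorphic_on_subset[OF holQ sub]) (auto simp: \<Omega>_def)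
  have sums: "(\<lambda>n. a n * of_nat n powr (- 1 - w)) sums F w" if w: "Re w > 0" for w
  proof -
    have nz': "w \<noteq> 0" "1 + w \<noteq> 0" using w nz[of w] by auto
    have eq: "a (Suc n) * of_nat (Suc n) powr (- 1 - w) =
        (of_real (chebyshev_psi (Suc n)) * zterm (Suc n) (2 + w)
          + of_real (chebyshev_psi (Suc n)) * (of_nat (Suc n) powr (- (1 + w)) - of_nat (Suc (Suc n)) powr (- (1 + w)))) / (1 + w)
          - of_nat (Suc n) powr (- (1 + w))" for n
    proof -
      define x where "x = complex_of_nat (Suc n)"
      define p where "p = chebyshev_psi (Suc n)"
      have x: "x \<noteq> 0" unfolding x_def by (rule of_nat_neq_0)
      have e1: "x powr (- 1 - w) = x * x powr (- (2 + w))"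
        using powr_add[of x 1 "- (2 + w)"] x by simp
      have z: "zterm (Suc n) (2 + w) = (1 + w) * x powr (- (2 + w)) - x powr (- (1 + w)) + of_nat (Suc (Suc n)) powr (- (1 + w))"
        unfolding zterm_def x_def by (simp add: algebra_simps del: of_nat_Suc)
      have "(of_real p * zterm (Suc n) (2 + w)
          + of_real p * (x powr (- (1 + w)) - of_nat (Suc (Suc n)) powr (- (1 + w)))) / (1 + w)
          = of_real p * ((1 + w) * x powr (- (2 + w))) / (1 + w)"
        unfolding z by (simp only: distrib_left[symmetric]) simp
      also have "\<dots> = of_real p * x powr (- (2 + w))" using nz' by simp
      also have "of_real p * x powr (- (2 + w)) - x powr (- (1 + w)) = (of_real p - x) / x * x powr (- 1 - w)"
      proof -
        have "- (1 + w) = - 1 - w" by simp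
        then show ?thesis unfolding e1 using x e1 by (simp add: field_simps)
      qed
      also have "(of_real p - x) / x = a (Suc n)" unfolding a_def p_def x_def by simp
      finally show ?thesis unfolding x_def p_def by simp
    qed
    have "(\<lambda>n. of_nat (Suc n) powr (- (1 + w))) sums zeta_series (1 + w)"
      using sums_zeta[of "1 + w"] w by (subst sums_Suc_iff) simp
    then have "(\<lambda>n. a (Suc n) * of_nat (Suc n) powr (- 1 - w)) sums
        ((H (2 + w) + mangoldt_series (1 + w)) / (1 + w) - zeta_series (1 + w))"
      unfolding eq using w
      by (intro sums_diff sums_divide sums_add H_sums sums_chebyshev_psi) auto
    then have "(\<lambda>n. a n * of_nat n powr (- 1 - w)) sums
        ((H (2 + w) + mangoldt_series (1 + w)) / (1 + w) - zeta_series (1 + w))"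
      by (subst (asm) sums_Suc_iff) simp
    also have "(H (2 + w) + mangoldt_series (1 + w)) / (1 + w) - zeta_series (1 + w) = F w"
    proof -
      have "zeta_series (1 + w) = zeta_reg (1 + w) / w"
        using zeta_reg_eq[of "1 + w"] w nz' by simp
      moreover have "mangoldt_series (1 + w) = 1 / w - deriv zeta_reg (1 + w) / zeta_reg (1 + w)"
        using mangoldt_series_eq[of "1 + w"] w by simp
      moreover have "zeta_reg (1 + w) \<noteq> 0" using zeta_reg_nonzero[of "1 + w"] w by simp
      ultimately show ?thesis
        using nz' by (simp add: F_def Q_def q_def diff_divide_distrib add_divide_distrib)
    qed
    finally show ?thesis .
  qed
  have "(\<lambda>N. \<Sum>n=1..N. a n / of_nat n) \<longlonglongrightarrow> F 0"
  proof (rule newman[where B = 4, OF _ open\<Omega> _ holF sums])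
    show "norm (a n) \<le> 4" for n
    proof -
      have "\<bar>chebyshev_psi n - real n\<bar> \<le> 4 * real n"
        using chebyshev_psi_le[of n] chebyshev_psi_nonneg[of n] by (simp add: abs_le_iff)
      then show ?thesis unfolding a_def norm_of_real by (cases "n = 0") (simp_all add: divide_simps)
    qed
    show "{w. Re w \<ge> 0} \<subseteq> \<Omega>" using zeta_reg_nonzero by (auto simp: \<Omega>_def)
  qed
  then have "(\<lambda>N. Re (\<Sum>n=1..N. a n / of_nat n)) \<longlonglongrightarrow> Re (F 0)" by (rule tendsto_Re)
  moreover have "a n / of_nat n = of_real ((chebyshev_psi n - real n) / (real n)\<^sup>2)" for n
    unfolding a_def by (simp add: power2_eq_square)
  then have "Re (\<Sum>n=1..N. a n / of_nat n) = (\<Sum>n=1..N. (chebyshev_psi n - real n) / (real n)\<^sup>2)" for N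
    by (simp only: of_real_sum[symmetric] Re_complex_of_real)
  ultimately show ?thesis by (auto simp: convergent_def)
qed

text \<open>If \<psi>(N) \<ge> b N with b > 1, monotonicity keeps \<psi>(n) - n above a fixed
  multiple of N on a whole block of n proportional to N. The block then adds a fixed positive amount
  to the series, against the Cauchy property. For b < 1 the block lies below N.\<close>

theorem chebyshev_psi_asymptotics: "(\<lambda>n. chebyshev_psi n / real n) \<longlonglongrightarrow> 1"
proof -
  define T where "T = (\<lambda>N. \<Sum>n=1..N. (chebyshev_psi n - real n) / (real n)\<^sup>2)"
  have Cauchy: "\<exists>N0. \<forall>M\<ge>N0. \<forall>N\<ge>N0. \<bar>T M - T N\<bar> < e" if "e > 0" for e
    using convergent_Cauchy[OF convergent_psi_series] that unfolding T_def[symmetric] Cauchy_def dist_real_def by blast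
  have T_diff: "T M - T N = (\<Sum>n\<in>{N<..M}. (chebyshev_psi n - real n) / (real n)\<^sup>2)" if "N \<le> M" for M N
  proof -
    have "{1..M} = {1..N} \<union> {N<..M}" using that by auto
    then show ?thesis unfolding T_def by (simp only:) (subst sum.union_disjoint, auto)
  qed
  have upper: "\<forall>\<^sub>F N in sequentially. chebyshev_psi N / real N < b" if b: "b > 1" for b
  proof -
    \<comment> \<open>The midpoint of 1 and \<open>b\<close>: blocks up to \<open>\<mu> * N\<close>
      have proportional length, and \<psi>(n) - n is still at least \<open>(b - \<mu>) * N\<close>
      on them. Each term is then at least \<open>k / N\<close>.\<close>
    define \<mu> where "\<mu> = (1 + b) / 2"
    have \<mu>: "1 < \<mu>" "\<mu> < b" using b by (auto simp: \<mu>_def)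
    define k where "k = (b - \<mu>) / \<mu>\<^sup>2"
    have k: "k > 0" using \<mu> by (simp add: k_def)
    obtain N0 where N0: "\<And>M N. M \<ge> N0 \<Longrightarrow> N \<ge> N0 \<Longrightarrow> \<bar>T M - T N\<bar> < (\<mu> - 1) / 2 * k"
      using Cauchy[of "(\<mu> - 1) / 2 * k"] \<mu> k by auto
    \<comment> \<open>Rounding may lose one term of the block; for such \<open>N\<close> at least
      half of \<open>(\<mu> - 1) * N\<close> remain.\<close>
    have "\<forall>\<^sub>F N in sequentially. real N \<ge> 2 / (\<mu> - 1)"
      using filterlim_real_sequentially by (simp add: filterlim_at_top)
    then show ?thesis using eventually_ge_at_top[of "max 1 N0"]
    proof eventually_elim
      case (elim N)
      show ?case
      proof (rule ccontr)
        assume "\<not> chebyshev_psi N / real N < b"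
        then have psi: "chebyshev_psi N \<ge> b * real N" using elim by (simp add: field_simps)
        define M where "M = nat \<lfloor>\<mu> * real N\<rfloor>"
        have "\<mu> * real N \<ge> real N" using \<mu> by (simp add: mult_le_cancel_right1)
        then have M: "real M \<le> \<mu> * real N" "real M > \<mu> * real N - 1" "N \<le> M"
          unfolding M_def by (auto simp: le_nat_floor)
        have "(\<Sum>n\<in>{N<..M}. k / real N) \<le> (\<Sum>n\<in>{N<..M}. (chebyshev_psi n - real n) / (real n)\<^sup>2)"
        proof (rule sum_mono)
          fix n assume n: "n \<in> {N<..M}"
          have 1: "(b - \<mu>) * real N \<le> chebyshev_psi n - real n"
            using psi chebyshev_psi_mono[of N n] n M(1) by (simp add: algebra_simps)
          have "real n \<le> \<mu> * real N" using n M(1) by simp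
          then have "(real n)\<^sup>2 \<le> (\<mu> * real N)\<^sup>2" by (intro power_mono) auto
          then have "(b - \<mu>) * real N / (\<mu> * real N)\<^sup>2 \<le> (chebyshev_psi n - real n) / (real n)\<^sup>2"
            using 1 n \<mu> order_trans[OF mult_nonneg_nonneg 1] by (intro frac_le) auto
          moreover have "(b - \<mu>) * real N / (\<mu> * real N)\<^sup>2 = k / real N"
            using elim \<mu> by (simp add: k_def power2_eq_square)
          ultimately show "k / real N \<le> (chebyshev_psi n - real n) / (real n)\<^sup>2" by simp
        qed
        then have "real (M - N) * (k / real N) \<le> T M - T N"
          using T_diff[OF M(3)] by simp
        moreover have "(\<mu> - 1) / 2 * k \<le> real (M - N) * (k / real N)"
        proof -
          have "1 \<le> (\<mu> - 1) / 2 * real N" using elim \<mu> by (simp add: field_simps)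
          moreover have "(\<mu> - 1) / 2 * real N = (\<mu> * real N - real N) / 2"
            by (simp add: algebra_simps diff_divide_distrib)
          moreover have "(y - real N) / 2 \<le> real (M - N)" if "1 \<le> (y - real N) / 2" "y - 1 < real M" for y
            using that M(3) by (simp add: of_nat_diff field_simps)
          ultimately have "(\<mu> - 1) / 2 * real N \<le> real (M - N)"
            using M(2) by metis
          then have "(\<mu> - 1) / 2 * real N * (k / real N) \<le> real (M - N) * (k / real N)"
            using k by (intro mult_right_mono) auto
          then show ?thesis using elim by simp
        qed
        moreover have "\<bar>T M - T N\<bar> < (\<mu> - 1) / 2 * k" using elim M(3) by (intro N0) auto
        ultimately show False by linarith
      qed
    qed
  qed
  have lower: "\<forall>\<^sub>F N in sequentially. chebyshev_psi N / real N > b" if b: "b < 1" "b > 0" for b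
  proof -
    define \<mu> where "\<mu> = (1 + b) / 2"
    have \<mu>: "\<mu> < 1" "b < \<mu>" "\<mu> > 0" using b by (auto simp: \<mu>_def)
    define k where "k = \<mu> - b"
    have k: "k > 0" using \<mu> by (simp add: k_def)
    obtain N0 where N0: "\<And>M N. M \<ge> N0 \<Longrightarrow> N \<ge> N0 \<Longrightarrow> \<bar>T M - T N\<bar> < (1 - \<mu>) / 2 * k"
      using Cauchy[of "(1 - \<mu>) / 2 * k"] \<mu> k by auto
    \<comment> \<open>The second bound ensures \<open>M \<ge> N0\<close>, as the block now starts
      below \<open>N\<close>.\<close>
    have "\<forall>\<^sub>F N in sequentially. real N \<ge> max (2 / (1 - \<mu>)) (real N0 / \<mu>)"
      using filterlim_real_sequentially unfolding filterlim_at_top by blast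
    then show ?thesis using eventually_ge_at_top[of "max 1 N0"]
    proof eventually_elim
      case (elim N)
      show ?case
      proof (rule ccontr)
        assume "\<not> chebyshev_psi N / real N > b"
        then have psi: "chebyshev_psi N \<le> b * real N" using elim by (simp add: field_simps)
        define M where "M = nat \<lceil>\<mu> * real N\<rceil>"
        have "\<mu> * real N \<le> real N" "\<mu> * real N \<ge> 0" using \<mu> by (simp_all add: mult_left_le_one_le)
        then have M: "real M \<ge> \<mu> * real N" "real M < \<mu> * real N + 1" "M \<le> N"
          unfolding M_def by (auto simp: ceiling_le_iff nat_le_iff) linarith+
        have "(\<Sum>n\<in>{M<..N}. (chebyshev_psi n - real n) / (real n)\<^sup>2) \<le> (\<Sum>n\<in>{M<..N}. - (k / real N))"
        proof (rule sum_mono)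
          fix n assume n: "n \<in> {M<..N}"
          have 1: "k * real N \<le> real n - chebyshev_psi n"
            using psi chebyshev_psi_mono[of n N] n M(1) by (simp add: k_def algebra_simps)
          have "(real n)\<^sup>2 \<le> (real N)\<^sup>2" using n by (intro power_mono) auto
          then have "k * real N / (real N)\<^sup>2 \<le> (real n - chebyshev_psi n) / (real n)\<^sup>2"
            using 1 n k order_trans[OF mult_nonneg_nonneg 1] by (intro frac_le) auto
          moreover have "k * real N / (real N)\<^sup>2 = k / real N"
            using elim by (simp add: power2_eq_square)
          ultimately show "(chebyshev_psi n - real n) / (real n)\<^sup>2 \<le> - (k / real N)"
            by (simp add: diff_divide_distrib)
        qed
        then have "T N - T M \<le> - (real (N - M) * (k / real N))"
          using T_diff[OF M(3)] by simp
        moreover have "(1 - \<mu>) / 2 * k \<le> real (N - M) * (k / real N)"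
        proof -
          have "1 \<le> (1 - \<mu>) / 2 * real N" using elim \<mu> by (simp add: field_simps)
          moreover have "(1 - \<mu>) / 2 * real N = (real N - \<mu> * real N) / 2"
            by (simp add: algebra_simps diff_divide_distrib)
          moreover have "(real N - y) / 2 \<le> real (N - M)" if "1 \<le> (real N - y) / 2" "real M < y + 1" for y
            using that M(3) by (simp add: of_nat_diff field_simps)
          ultimately have "(1 - \<mu>) / 2 * real N \<le> real (N - M)"
            using M(2) by metis
          then have "(1 - \<mu>) / 2 * real N * (k / real N) \<le> real (N - M) * (k / real N)"
            using k by (intro mult_right_mono) auto
          then show ?thesis using elim by simp
        qed
        moreover have "real N0 \<le> real M"
          using elim \<mu> M(1) by (simp add: field_simps)
        then have "\<bar>T N - T M\<bar> < (1 - \<mu>) / 2 * k" using elim by (intro N0) auto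
        ultimately show False by linarith
      qed
    qed
  qed
  show ?thesis
  proof (rule order_tendstoI)
    fix x :: real assume x: "x < 1"
    \<comment> \<open>\<open>lower\<close> asks for a positive bound, so \<open>x\<close> is raised
      to at least 1/2.\<close>
    have "\<forall>\<^sub>F N in sequentially. chebyshev_psi N / real N > max x (1 / 2)" using x by (intro lower) auto
    then show "\<forall>\<^sub>F N in sequentially. x < chebyshev_psi N / real N" by eventually_elim simp
  qed (rule upper)
qed

section \<open>From the Chebyshev function to the prime count\<close>

lemma finite_primes_le: "finite {p::nat. prime p \<and> p \<le> n}"
  by (rule finite_subset[of _ "{..n}"]) auto

lemma prime_count_nat: "prime_count (real n) = card {p. prime p \<and> p \<le> n}"
  by (simp add: prime_count_def)

text \<open>A prime p has at most ln n / ln p powers up to n, each contributing ln p, hence at most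
  ln n in all.\<close>

lemma chebyshev_psi_le_prime_count: "chebyshev_psi n \<le> real (prime_count (real n)) * ln (real n)"
proof (cases "n = 0")
  case False
  define S where "S = {d\<in>{1..n}. primepow d}"
  define T where "T = {p. prime p \<and> p \<le> n}"
  have finT: "finite T" unfolding T_def by (rule finite_primes_le)
  have img: "aprimedivisor ` S \<subseteq> T"
  proof safe
    fix d assume "d \<in> S"
    then have d: "primepow d" "d > 1" "d \<le> n" by (auto simp: S_def dest: primepow_gt_Suc_0)
    then have "aprimedivisor d dvd d" "prime (aprimedivisor d)"
      by (auto intro!: aprimedivisor_dvd' prime_aprimedivisor')
    then show "aprimedivisor d \<in> T" using d by (auto simp: T_def dest!: dvd_imp_le)
  qed
  have "chebyshev_psi n = (\<Sum>d\<in>S. ln (real (aprimedivisor d)))"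
    unfolding chebyshev_psi_def S_def mangoldt_def by (intro sum.mono_neutral_cong_right) auto
  also have "\<dots> = (\<Sum>p\<in>T. \<Sum>d\<in>{d\<in>S. aprimedivisor d = p}. ln (real (aprimedivisor d)))"
    using finT img by (intro sum.group[symmetric]) (auto simp: S_def)
  also have "\<dots> \<le> (\<Sum>p\<in>T. ln (real n))"
  proof (rule sum_mono)
    fix p assume p: "p \<in> T"
    then have p': "prime p" "p \<le> n" "ln (real p) > 0"
      using prime_gt_1_nat[of p] by (auto simp: T_def)
    define K where "K = nat \<lfloor>ln (real n) / ln (real p)\<rfloor>"
    have "{d\<in>S. aprimedivisor d = p} \<subseteq> (\<lambda>k. p ^ k) ` {1..K}"
    proof safe
      fix d assume d: "d \<in> S" "p = aprimedivisor d"
      define k where "k = multiplicity p d"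
      have pd: "primepow d" "d \<le> n" "d > 1" using d by (auto simp: S_def dest: primepow_gt_Suc_0)
      have eq: "d = p ^ k" using primepow_decompose[OF pd(1)] d(2) by (simp add: k_def)
      then have "k \<noteq> 0" using pd(3) by (cases "k = 0") auto
      have "real k * ln (real p) = ln (real d)" using eq p' by (simp add: ln_realpow prime_gt_0_nat)
      also have "\<dots> \<le> ln (real n)" using pd by simp
      finally have "real k \<le> ln (real n) / ln (real p)" using p' by (simp add: field_simps)
      then have "k \<le> K" by (simp add: K_def le_nat_floor)
      then show "d \<in> (^) (aprimedivisor d) ` {1..K}" using eq \<open>k \<noteq> 0\<close> d(2) by auto
    qed
    then have "card {d\<in>S. aprimedivisor d = p} \<le> card ((\<lambda>k. p ^ k) ` {1..K})"
      by (intro card_mono) auto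
    also have "\<dots> \<le> card {1..K}" by (intro card_image_le) auto
    finally have "card {d\<in>S. aprimedivisor d = p} \<le> K" by simp
    moreover have "real K \<le> ln (real n) / ln (real p)"
      using False p' by (simp add: K_def)
    ultimately have "real (card {d\<in>S. aprimedivisor d = p}) \<le> ln (real n) / ln (real p)" by linarith
    then have "real (card {d\<in>S. aprimedivisor d = p}) * ln (real p) \<le> ln (real n)"
      using p' by (simp add: field_simps)
    then show "(\<Sum>d\<in>{d\<in>S. aprimedivisor d = p}. ln (real (aprimedivisor d))) \<le> ln (real n)" by simp
  qed
  finally show ?thesis by (simp add: T_def prime_count_nat)
qed simp

text \<open>Primes up to the threshold \<open>m\<close> are counted trivially; each larger one
  contributes at least \<open>ln m\<close> to \<psi>(n).\<close>

lemma prime_count_le: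
  assumes "m > 1"
  shows "real (prime_count (real n)) \<le> m + chebyshev_psi n / ln m"
proof -
  define A where "A = {p. prime p \<and> p \<le> n \<and> real p \<le> m}"
  define B where "B = {p. prime p \<and> p \<le> n \<and> real p > m}"
  have fin: "finite A" "finite B" using finite_primes_le[of n] by (auto simp: A_def B_def)
  have "prime_count (real n) = card (A \<union> B)"
    unfolding prime_count_nat A_def B_def by (rule arg_cong[of _ _ card]) auto
  also have "\<dots> \<le> card A + card B" by (rule card_Un_le)
  finally have 1: "real (prime_count (real n)) \<le> real (card A) + real (card B)" by linarith
  have "A \<subseteq> {1..nat \<lfloor>m\<rfloor>}" by (auto simp: A_def le_nat_floor Suc_le_eq prime_gt_0_nat)
  then have "card A \<le> nat \<lfloor>m\<rfloor>" using card_mono[of "{1..nat \<lfloor>m\<rfloor>}" A] by simp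
  then have 2: "real (card A) \<le> m" using assms by linarith
  have "real (card B) * ln m = (\<Sum>p\<in>B. ln m)" by simp
  also have "\<dots> \<le> (\<Sum>p\<in>B. mangoldt p)"
    using assms by (intro sum_mono) (auto simp: B_def)
  also have "\<dots> \<le> chebyshev_psi n"
    unfolding chebyshev_psi_def by (intro sum_mono2 mangoldt_nonneg) (auto simp: B_def Suc_le_eq prime_gt_0_nat)
  finally have "real (card B) \<le> chebyshev_psi n / ln m" using assms by (simp add: field_simps)
  with 1 2 show ?thesis by linarith
qed

lemma prime_count_tendsto:
  "(\<lambda>n. real (prime_count (real n)) * ln (real n) / real n) \<longlonglongrightarrow> 1"
proof (rule tendsto_sandwich)
  show "\<forall>\<^sub>F n in sequentially. chebyshev_psi n / real n \<le> real (prime_count (real n)) * ln (real n) / real n"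
    using chebyshev_psi_le_prime_count by (intro always_eventually allI divide_right_mono) auto
  \<comment> \<open>The threshold n / ln^2 n is o(n / ln n), and yet its logarithm is asymptotic to
    ln n.\<close>
  have "\<forall>\<^sub>F n in sequentially. real n / (ln (real n))\<^sup>2 > 1" by real_asymp
  moreover have "\<forall>\<^sub>F n in sequentially. ln (real n) > 0" by real_asymp
  ultimately show "\<forall>\<^sub>F n in sequentially. real (prime_count (real n)) * ln (real n) / real n
      \<le> 1 / ln (real n) + chebyshev_psi n / real n * (ln (real n) / ln (real n / (ln (real n))\<^sup>2))"
  proof eventually_elim
    case (elim n)
    have n: "real n > 0" using elim by (cases "n = 0") auto
    have "real (prime_count (real n)) * ln (real n) / real n
        \<le> (real n / (ln (real n))\<^sup>2 + chebyshev_psi n / ln (real n / (ln (real n))\<^sup>2)) * ln (real n) / real n"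
      using elim by (intro divide_right_mono mult_right_mono prime_count_le) auto
    also have "\<dots> = 1 / ln (real n) + chebyshev_psi n / real n * (ln (real n) / ln (real n / (ln (real n))\<^sup>2))"
      using elim n by (simp add: distrib_right add_divide_distrib power2_eq_square)
    finally show ?case .
  qed
  have "(\<lambda>n. 1 / ln (real n) + chebyshev_psi n / real n * (ln (real n) / ln (real n / (ln (real n))\<^sup>2))) \<longlonglongrightarrow> 0 + 1 * 1"
    by (intro tendsto_add tendsto_mult chebyshev_psi_asymptotics; real_asymp)
  then show "(\<lambda>n. 1 / ln (real n) + chebyshev_psi n / real n * (ln (real n) / ln (real n / (ln (real n))\<^sup>2))) \<longlonglongrightarrow> 1"
    by simp
qed (rule chebyshev_psi_asymptotics)

theorem prime_number_theorem:
  "(\<lambda>n. real (prime_count (real n))) \<sim>[at_top] (\<lambda>n. real n / ln (real n))"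
  using prime_count_tendsto by (intro asymp_equivI') simp

section \<open>Monomial ideals\<close>

lemma monom_in_carrier: "a \<in> exponents r \<Longrightarrow> monom a \<in> carrier (poly_ring r)"
  by (simp add: poly_ring_simps monom_def)

text \<open>Membership in a monomial ideal is decided term by term: the right-hand side is an ideal
  containing the generators, and conversely each of its elements is a sum of multiples of
  them.\<close>

lemma genideal_monom:
  fixes A :: "expvec set"
  assumes A: "A \<subseteq> exponents r"
  shows "Idl\<^bsub>poly_ring r\<^esub> (monom ` A :: 'k::field mpoly set)
    = {f \<in> carrier (poly_ring r). \<forall>b\<in>Poly_Mapping.keys f. \<exists>a\<in>A. \<exists>c. b = a + c}" (is "?I = ?J")
proof
  interpret cring "poly_ring r :: 'k mpoly ring" by (rule cring_poly_ring)
  have sub: "monom ` A \<subseteq> (carrier (poly_ring r) :: 'k mpoly set)"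
    using A monom_in_carrier by blast
  have a_inv: "\<ominus>\<^bsub>poly_ring r\<^esub> f = - f" if "f \<in> carrier (poly_ring r)" for f :: "'k mpoly"
    using that by (intro minus_equality) (auto simp: poly_ring_simps in_keys_iff)
  have "ideal ?J (poly_ring r)"
  proof (rule idealI)
    show "subgroup ?J (add_monoid (poly_ring r))"
    proof (rule group.subgroupI)
      show "group (add_monoid (poly_ring r :: 'k mpoly ring))" by (rule a_group)
      show "?J \<subseteq> carrier (add_monoid (poly_ring r))" by auto
      have "0 \<in> ?J" by (simp add: poly_ring_simps)
      then show "?J \<noteq> {}" by blast
    next
      fix f assume f: "f \<in> ?J"
      then have "inv\<^bsub>add_monoid (poly_ring r)\<^esub> f = - f" using a_inv by (simp add: a_inv_def)
      moreover have "Poly_Mapping.keys (- f) = Poly_Mapping.keys f" by (auto simp: in_keys_iff)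
      ultimately show "inv\<^bsub>add_monoid (poly_ring r)\<^esub> f \<in> ?J" using f by (simp add: poly_ring_simps)
    next
      fix f g assume "f \<in> ?J" "g \<in> ?J"
      then show "f \<otimes>\<^bsub>add_monoid (poly_ring r)\<^esub> g \<in> ?J"
        using keys_add[of f g] by (auto simp: poly_ring_simps)
    qed
  next
    have mult: "g * f \<in> ?J" if "f \<in> ?J" "g \<in> carrier (poly_ring r)" for f g
    proof -
      have "g * f \<in> carrier (poly_ring r)" using m_closed[of g f] that by (simp add: poly_ring_simps)
      moreover have "\<exists>a\<in>A. \<exists>c. b = a + c" if b: "b \<in> Poly_Mapping.keys (g * f)" for b
      proof -
        obtain u v where "b = u + v" "v \<in> Poly_Mapping.keys f" using b keys_mult[of g f] by blast
        moreover obtain a c where "a \<in> A" "v = a + c" using \<open>f \<in> ?J\<close> \<open>v \<in> Poly_Mapping.keys f\<close> by blast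
        ultimately have "b = a + (u + c)" by (simp add: add_ac)
        with \<open>a \<in> A\<close> show ?thesis by blast
      qed
      ultimately show ?thesis by blast
    qed
    fix f g :: "'k mpoly" assume "f \<in> ?J" "g \<in> carrier (poly_ring r)"
    then show "g \<otimes>\<^bsub>poly_ring r\<^esub> f \<in> ?J" "f \<otimes>\<^bsub>poly_ring r\<^esub> g \<in> ?J"
      using mult[of f g] by (simp_all add: poly_ring_simps mult.commute)
  qed (rule ring_axioms)
  moreover have "monom ` A \<subseteq> ?J"
  proof
    fix f :: "'k mpoly" assume "f \<in> monom ` A"
    then obtain a where a: "a \<in> A" "f = monom a" by blast
    then have "\<exists>a'\<in>A. \<exists>c. a = a' + c" by (intro bexI[of _ a] exI[of _ 0]) auto
    with a A show "f \<in> ?J" by (auto simp: monom_def poly_ring_simps)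
  qed
  ultimately show "?I \<subseteq> ?J" by (rule genideal_minimal)
  have ideal: "ideal ?I (poly_ring r)" by (rule genideal_ideal[OF sub])
  show "?J \<subseteq> ?I"
  proof
    fix f assume f: "f \<in> ?J"
    have term_in: "Poly_Mapping.single b (Poly_Mapping.lookup f b) \<in> ?I" if b: "b \<in> Poly_Mapping.keys f" for b
    proof -
      obtain a c where ac: "a \<in> A" "b = a + c" using f b by blast
      have "b \<in> exponents r" using f b by (auto simp: poly_ring_simps)
      \<comment> \<open>Exponents are natural numbers, so nothing cancels in \<open>a + c\<close>
        and a variable of \<open>c\<close> is one of \<open>b\<close>.\<close>
      then have "c \<in> exponents r" using ac by (auto simp: exponents_def in_keys_iff lookup_add)
      then have "Poly_Mapping.single c (Poly_Mapping.lookup f b) \<in> carrier (poly_ring r)"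
        by (auto simp: poly_ring_simps)
      moreover have "(monom a :: 'k mpoly) \<in> ?I" using genideal_self[OF sub] ac(1) by blast
      ultimately have "Poly_Mapping.single c (Poly_Mapping.lookup f b) \<otimes>\<^bsub>poly_ring r\<^esub> monom a \<in> ?I"
        by (intro ideal.I_l_closed[OF ideal])
      then show ?thesis using ac(2) by (simp add: poly_ring_simps monom_def mult_single add.commute)
    qed
    have "(\<Sum>b\<in>B. Poly_Mapping.single b (Poly_Mapping.lookup f b)) \<in> ?I" if "finite B" "B \<subseteq> Poly_Mapping.keys f" for B
      using that
    proof (induction B)
      case empty
      then show ?case using additive_subgroup.zero_closed[OF ideal.axioms(1)[OF ideal]] by (simp add: poly_ring_simps)
    next
      case (insert b B)
      then show ?case
        using additive_subgroup.a_closed[OF ideal.axioms(1)[OF ideal] term_in[of b]] by (simp add: poly_ring_simps)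
    qed
    then have "(\<Sum>b\<in>Poly_Mapping.keys f. Poly_Mapping.single b (Poly_Mapping.lookup f b)) \<in> ?I" by simp
    moreover have "(\<Sum>b\<in>Poly_Mapping.keys f. Poly_Mapping.single b (Poly_Mapping.lookup f b)) = f"
      by (rule poly_mapping_eqI) (auto simp: lookup_sum lookup_single when_def in_keys_iff)
    ultimately show "f \<in> ?I" by simp
  qed
qed

lemma monom_in_genideal_iff:
  assumes "A \<subseteq> exponents r" "b \<in> exponents r"
  shows "(monom b :: 'k::field mpoly) \<in> Idl\<^bsub>poly_ring r\<^esub> (monom ` A) \<longleftrightarrow> (\<exists>a\<in>A. \<exists>c. b = a + c)"
  unfolding genideal_monom[OF assms(1)] using monom_in_carrier[OF assms(2), where ?'a = 'k]
  by (simp add: monom_def)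

lemma genideal_monom_eqI:
  assumes "A \<subseteq> exponents r" "B \<subseteq> exponents r"
    and "\<And>b. b \<in> exponents r \<Longrightarrow> (\<exists>a\<in>A. \<exists>c. b = a + c) \<longleftrightarrow> (\<exists>a\<in>B. \<exists>c. b = a + c)"
  shows "Idl\<^bsub>poly_ring r\<^esub> (monom ` A :: 'k::field mpoly set) = Idl\<^bsub>poly_ring r\<^esub> (monom ` B)"
  unfolding genideal_monom[OF assms(1)] genideal_monom[OF assms(2)]
  by (rule Collect_cong, rule conj_cong[OF refl], rule ball_cong[OF refl], rule assms(3))
    (auto simp: poly_ring_simps)

lemma inj_monom: "inj (monom :: expvec \<Rightarrow> 'k::field mpoly)"
  unfolding inj_def monom_def by (metis keys_single one_neq_zero singleton_inject)

section \<open>Multiplicativity of the weight and minimal monomials\<close>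

lemma weight_eq_prod:
  assumes "finite B" "Poly_Mapping.keys a \<subseteq> B"
  shows "weight a = (\<Prod>i\<in>B. nth_prime i ^ Poly_Mapping.lookup a i)"
  unfolding weight_def using assms by (intro prod.mono_neutral_left) (auto simp: in_keys_iff)

lemma weight_add: "weight (a + b) = weight a * weight b"
proof -
  define B where "B = Poly_Mapping.keys a \<union> Poly_Mapping.keys b"
  have B: "finite B" "Poly_Mapping.keys (a + b) \<subseteq> B" "Poly_Mapping.keys a \<subseteq> B" "Poly_Mapping.keys b \<subseteq> B"
    using keys_add[of a b] by (auto simp: B_def)
  show ?thesis
    unfolding weight_eq_prod[OF B(1,2)] weight_eq_prod[OF B(1,3)] weight_eq_prod[OF B(1,4)]
    by (simp add: lookup_add power_add prod.distrib)
qed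

lemma prime_nth_prime: "prime (nth_prime i)"
  using enumerate_in_set[OF primes_infinite] by (simp add: nth_prime_def)

lemma weight_pos: "weight a > 0"
  unfolding weight_def by (intro prod_pos) (simp add: prime_gt_0_nat[OF prime_nth_prime])

lemma weight_eq_1_iff: "weight a = 1 \<longleftrightarrow> a = 0"
proof
  assume w: "weight a = 1"
  show "a = 0"
  proof (rule ccontr)
    assume "a \<noteq> 0"
    then obtain i where i: "i \<in> Poly_Mapping.keys a" by (metis keys_eq_empty all_not_in_conv)
    then have "nth_prime i ^ Poly_Mapping.lookup a i dvd weight a"
      unfolding weight_def by (intro dvd_prodI) auto
    then have "nth_prime i ^ Poly_Mapping.lookup a i = 1" using w by simp
    then show False using i prime_gt_1_nat[OF prime_nth_prime[of i]] by (auto simp: in_keys_iff)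
  qed
qed (simp add: weight_def)

definition min_expvecs :: "nat \<Rightarrow> nat \<Rightarrow> expvec set" where
  "min_expvecs r n = {m \<in> exponents r. weight m > n \<and>
    (\<forall>a\<in>exponents r. weight a > n \<longrightarrow> (\<exists>c. m = a + c) \<longrightarrow> a = m)}"

text \<open>Every monomial generating set must contain each minimal monomial, since an ideal member
  is a multiple of a generator. The minimal monomials already generate, so they form the unique
  irredundant set and the \<open>THE\<close> is well defined.\<close>

lemma min_monomial_gens_eq:
  defines "W \<equiv> \<lambda>r n. {a \<in> exponents r. weight a > n}"
  shows "min_monomial_gens r (Idl\<^bsub>poly_ring r\<^esub> (monom ` W r n) :: 'k::field mpoly set) = monom ` min_expvecs r n"
proof -
  let ?M = "min_expvecs r n"
  let ?I = "Idl\<^bsub>poly_ring r\<^esub> (monom ` W r n) :: 'k mpoly set"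
  have sub: "W r n \<subseteq> exponents r" "?M \<subseteq> exponents r" "?M \<subseteq> W r n" by (auto simp: W_def min_expvecs_def)
  have ex_min: "\<exists>a\<in>?M. \<exists>c. b = a + c" if b: "b \<in> W r n" for b
  proof -
    define X where "X = {a \<in> W r n. \<exists>c. b = a + c}"
    have "b = b + 0" by simp
    with b have "b \<in> X" unfolding X_def by blast
    \<comment> \<open>A divisor of least weight is minimal: a proper divisor would have a cofactor
      of weight 1, that is, exponent vector 0.\<close>
    then obtain a where a: "a \<in> X" "\<And>a'. a' \<in> X \<Longrightarrow> weight a \<le> weight a'"
      using ex_has_least_nat[of "\<lambda>x. x \<in> X" b weight] by blast
    obtain c where c: "b = a + c" using a(1) by (auto simp: X_def)
    have "a' = a" if a': "a' \<in> W r n" "a = a' + d" for a' d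
    proof -
      have "b = a' + (d + c)" using c a' by (simp add: add_ac)
      with a'(1) have "a' \<in> X" by (auto simp: X_def)
      then have "weight a \<le> weight a'" by (rule a(2))
      then have "weight d = 1" using a'(2) weight_pos[of a'] weight_pos[of d] by (simp add: weight_add)
      then show ?thesis using a'(2) weight_eq_1_iff by simp
    qed
    then have "a \<in> ?M" using a(1) by (auto simp: X_def W_def min_expvecs_def)
    with c show ?thesis by blast
  qed
  have up: "(\<exists>a\<in>W r n. \<exists>c. b = a + c) \<longleftrightarrow> (\<exists>a\<in>?M. \<exists>c. b = a + c)" if "b \<in> exponents r" for b
  proof
    assume "\<exists>a\<in>W r n. \<exists>c. b = a + c"
    then obtain a c where a: "a \<in> W r n" "b = a + c" by blast
    then obtain m d where m: "m \<in> ?M" "a = m + d" using ex_min by blast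
    then have "b = m + (d + c)" using a(2) by (simp add: add_ac)
    with m(1) show "\<exists>a\<in>?M. \<exists>c. b = a + c" by blast
  qed (use sub(3) in blast)
  have contains_M: "?M \<subseteq> A" if A: "A \<subseteq> exponents r" "Idl\<^bsub>poly_ring r\<^esub> (monom ` A) = ?I" for A
  proof
    fix m assume m: "m \<in> ?M"
    have "m = m + 0" by simp
    then have "monom m \<in> ?I" using m sub monom_in_genideal_iff[OF sub(1), of m] by blast
    moreover have "m \<in> exponents r" using m sub by blast
    ultimately obtain a c where a: "a \<in> A" "m = a + c"
      using A(2) monom_in_genideal_iff[OF A(1), of m, where ?'k = 'k] by auto
    have "a = a + 0" by simp
    then have "monom a \<in> ?I" using a A monom_in_genideal_iff[OF A(1), of a, where ?'k = 'k] by blast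
    then obtain w d where w: "w \<in> W r n" "a = w + d"
      using a A monom_in_genideal_iff[OF sub(1), of a, where ?'k = 'k] by blast
    have "n < weight w" using w by (simp add: W_def)
    also have "weight w \<le> weight a" using w weight_pos[of d] by (simp add: weight_add)
    finally have "weight a > n" .
    then have "a = m" using m a A(1) by (auto simp: min_expvecs_def)
    with a(1) show "m \<in> A" by simp
  qed
  have I_M: "Idl\<^bsub>poly_ring r\<^esub> (monom ` ?M) = ?I"
    by (rule genideal_monom_eqI[OF sub(2,1)]) (simp add: up)
  have subset_image: "\<exists>B\<subseteq>A. H = monom ` B" if "H \<subseteq> monom ` A" for H :: "'k mpoly set" and A
    using that by (simp add: subset_image_iff)
  have "is_min_monomial_gens r ?I (monom ` ?M)"
    unfolding is_min_monomial_gens_def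
  proof (intro conjI allI impI)
    fix H :: "'k mpoly set" assume H: "H \<subset> monom ` ?M"
    then obtain B where B: "B \<subseteq> ?M" "H = monom ` B" using subset_image[of H ?M] by blast
    show "Idl\<^bsub>poly_ring r\<^esub> H \<noteq> ?I"
    proof
      assume "Idl\<^bsub>poly_ring r\<^esub> H = ?I"
      then have "?M \<subseteq> B" using contains_M[of B] B sub by auto
      then show False using H B by auto
    qed
  qed (use sub I_M in auto)
  moreover have "G = monom ` ?M" if G: "is_min_monomial_gens r ?I G" for G
  proof -
    have Gs: "G \<subseteq> monom ` exponents r" and GI: "Idl\<^bsub>poly_ring r\<^esub> G = ?I"
      and min: "\<And>H. H \<subset> G \<Longrightarrow> Idl\<^bsub>poly_ring r\<^esub> H \<noteq> ?I"
      using G by (auto simp: is_min_monomial_gens_def)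
    obtain A where A: "A \<subseteq> exponents r" "G = monom ` A" using subset_image[OF Gs] by auto
    have "?M \<subseteq> A" using contains_M[OF A(1)] GI A(2) by simp
    then have "monom ` ?M \<subseteq> G" using A by auto
    then show ?thesis using min[of "monom ` ?M"] I_M by (metis psubsetI)
  qed
  ultimately show ?thesis unfolding min_monomial_gens_def by (rule the_equality)
qed

lemma num_gens_eq_card_min_expvecs:
  "num_gens (K :: 'k::field itself) n = card (min_expvecs (prime_count (real n)) n)"
  unfolding num_gens_def weight_ideal_def Let_def min_monomial_gens_eq
  by (intro card_image inj_on_subset[OF inj_monom]) auto

section \<open>Minimal generators as integers\<close>

lemma downward_closed_nat_set:
  fixes D :: "nat set"
  assumes "finite D" and "\<And>i j. j \<in> D \<Longrightarrow> i \<le> j \<Longrightarrow> i \<in> D"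
  shows "D = {..<card D}"
proof -
  define k where "k = (LEAST k. k \<notin> D)"
  obtain k0 where "k0 \<notin> D" using assms(1) infinite_UNIV_nat by (metis UNIV_I finite_subset subsetI)
  then have k: "k \<notin> D" unfolding k_def by (rule LeastI)
  have "i \<in> D" if "i < k" for i using not_less_Least[of i] that unfolding k_def by blast
  moreover have "i < k" if "i \<in> D" for i using assms(2)[OF that] k by (meson not_le)
  ultimately have "D = {..<k}" by auto
  then show ?thesis by simp
qed

lemma bij_betw_nth_prime:
  "bij_betw nth_prime {1..prime_count (real n)} {p. prime p \<and> p \<le> n}"
proof -
  define e where "e = enumerate {p::nat. prime p}"
  define D where "D = {i. e i \<le> n}"
  have mono: "strict_mono e" unfolding e_def by (rule strict_mono_enumerate[OF primes_infinite])
  have inj: "inj e" using mono by (rule strict_mono_imp_inj_on)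
  have img: "e ` D = {p. prime p \<and> p \<le> n}"
  proof (intro equalityI subsetI)
    fix p assume "p \<in> e ` D"
    then show "p \<in> {p. prime p \<and> p \<le> n}"
      using enumerate_in_set[OF primes_infinite] by (auto simp: D_def e_def)
  next
    fix p assume "p \<in> {p. prime p \<and> p \<le> n}"
    then obtain i where "e i = p" "p \<le> n" using enumerate_Ex[OF primes_infinite, of p] by (auto simp: e_def)
    then show "p \<in> e ` D" by (auto simp: D_def)
  qed
  have "finite (e ` D)" unfolding img by (rule finite_primes_le)
  then have fin: "finite D" using inj by (meson finite_imageD inj_on_subset subset_UNIV)
  have card: "card D = prime_count (real n)"
    unfolding prime_count_nat img[symmetric] by (rule card_image[symmetric]) (meson inj inj_on_subset subset_UNIV)
  \<comment> \<open>The enumeration is increasing, so the indices of primes up to \<open>n\<close>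
    form an initial segment, determined by its cardinality.\<close>
  have "D = {..<card D}"
  proof (rule downward_closed_nat_set[OF fin])
    show "i \<in> D" if "j \<in> D" "i \<le> j" for i j
      using that strict_mono_leD[OF mono, of i j] by (simp add: D_def)
  qed
  then have D: "D = {..<prime_count (real n)}" by (simp add: card)
  have "bij_betw e D {p. prime p \<and> p \<le> n}"
    using img inj_on_subset[OF inj subset_UNIV] by (simp add: bij_betw_def)
  moreover have "bij_betw (\<lambda>i. i - 1) {1..prime_count (real n)} D"
    unfolding D by (rule bij_betw_byWitness[of _ Suc]) auto
  ultimately have "bij_betw (e \<circ> (\<lambda>i. i - 1)) {1..prime_count (real n)} {p. prime p \<and> p \<le> n}"
    by (rule bij_betw_trans[rotated])
  moreover have "e \<circ> (\<lambda>i. i - 1) = nth_prime" by (simp add: fun_eq_iff nth_prime_def e_def)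
  ultimately show ?thesis by simp
qed

definition smooth :: "nat \<Rightarrow> nat set" where
  "smooth n = {N. N > 0 \<and> (\<forall>p. prime p \<longrightarrow> p dvd N \<longrightarrow> p \<le> n)}"

lemma smooth_dvd: "N \<in> smooth n \<Longrightarrow> d dvd N \<Longrightarrow> d \<in> smooth n"
  by (auto simp: smooth_def intro: dvd_trans dest: dvd_pos_nat)

text \<open>Unique factorisation: exponents are recovered as multiplicities of the primes up to
  \<open>n\<close>.\<close>

lemma bij_betw_weight: "bij_betw weight (exponents (prime_count (real n))) (smooth n)"
proof -
  define r where "r = prime_count (real n)"
  define P where "P = {p. prime p \<and> p \<le> n}"
  define idx where "idx = inv_into {1..r} nth_prime"
  have bij: "bij_betw nth_prime {1..r} P" unfolding r_def P_def by (rule bij_betw_nth_prime)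
  have finP: "finite P" unfolding P_def by (rule finite_primes_le)
  have idx: "idx (nth_prime i) = i" if "i \<in> {1..r}" for i
    unfolding idx_def using bij that by (simp add: bij_betw_inv_into_left)
  have reindex: "(\<Prod>i\<in>{1..r}. nth_prime i ^ f i) = (\<Prod>p\<in>P. p ^ f (idx p))" for f :: "nat \<Rightarrow> nat"
    unfolding prod.reindex_bij_betw[OF bij, symmetric] using idx by (intro prod.cong) auto
  have weight_eq: "weight a = (\<Prod>p\<in>P. p ^ Poly_Mapping.lookup a (idx p))" if "a \<in> exponents r" for a
    using that weight_eq_prod[of "{1..r}" a] reindex by (simp add: exponents_def)
  have mult: "multiplicity (nth_prime i) (weight a) = Poly_Mapping.lookup a i" if "a \<in> exponents r" "i \<in> {1..r}" for a i
  proof -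
    have "nth_prime i \<in> P" using bij that by (auto simp: bij_betw_def)
    then show ?thesis
      unfolding weight_eq[OF that(1)]
      using that idx[OF that(2)] finP by (subst multiplicity_prod_prime_powers) (auto simp: P_def)
  qed
  have inj: "inj_on weight (exponents r)"
  proof (rule inj_onI)
    fix a b assume ab: "a \<in> exponents r" "b \<in> exponents r" "weight a = weight b"
    show "a = b"
    proof (rule poly_mapping_eqI)
      fix i
      show "Poly_Mapping.lookup a i = Poly_Mapping.lookup b i"
      proof (cases "i \<in> {1..r}")
        case True
        then show ?thesis using mult[OF ab(1) True] mult[OF ab(2) True] ab(3) by simp
      next
        case False
        then have "i \<notin> Poly_Mapping.keys a" "i \<notin> Poly_Mapping.keys b" using ab by (auto simp: exponents_def)
        then show ?thesis by (simp add: in_keys_iff)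
      qed
    qed
  qed
  have "weight ` exponents r = smooth n"
  proof (intro equalityI subsetI)
    fix N assume "N \<in> weight ` exponents r"
    then obtain a where a: "a \<in> exponents r" "N = weight a" by blast
    have "q \<le> n" if q: "prime q" "q dvd N" for q
    proof -
      obtain p where p: "p \<in> P" "q dvd p ^ Poly_Mapping.lookup a (idx p)"
        using q a(2) unfolding weight_eq[OF a(1)] by (auto simp: prime_dvd_prod_iff[OF finP])
      then have "q dvd p" using q(1) prime_dvd_power by blast
      then have "q = p" using p q(1) by (auto simp: P_def intro: primes_dvd_imp_eq)
      then show ?thesis using p by (simp add: P_def)
    qed
    then show "N \<in> smooth n" using a(2) weight_pos[of a] by (simp add: smooth_def)
  next
    fix N assume N: "N \<in> smooth n"
    define f where "f = (\<lambda>i. if i \<in> {1..r} then multiplicity (nth_prime i) N else 0)"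
    have fin: "finite {i. f i \<noteq> 0}" by (rule finite_subset[of _ "{1..r}"]) (auto simp: f_def)
    define a where "a = Abs_poly_mapping f"
    have look: "Poly_Mapping.lookup a = f" unfolding a_def using fin by simp
    have a: "a \<in> exponents r" by (auto simp: exponents_def in_keys_iff look f_def split: if_splits)
    have "weight a = (\<Prod>p\<in>P. p ^ f (idx p))" using weight_eq[OF a] by (simp add: look)
    also have "\<dots> = (\<Prod>i\<in>{1..r}. nth_prime i ^ f i)" by (rule reindex[symmetric])
    also have "\<dots> = (\<Prod>i\<in>{1..r}. nth_prime i ^ multiplicity (nth_prime i) N)"
      by (intro prod.cong) (auto simp: f_def)
    also have "\<dots> = (\<Prod>p\<in>P. p ^ multiplicity p N)" by (rule prod.reindex_bij_betw[OF bij])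
    also have "\<dots> = (\<Prod>p\<in>prime_factors N. p ^ multiplicity p N)"
      using N finP by (intro prod.mono_neutral_right)
        (auto simp: smooth_def P_def prime_factors_dvd not_dvd_imp_multiplicity_0)
    also have "\<dots> = N" using N prime_factorization_nat[of N] by (simp add: smooth_def)
    finally show "N \<in> weight ` exponents r" using a by blast
  qed
  with inj show ?thesis unfolding bij_betw_def r_def by blast
qed

definition min_weights :: "nat \<Rightarrow> nat set" where
  "min_weights n = {N \<in> smooth n. N > n \<and> (\<forall>d. d dvd N \<longrightarrow> d > n \<longrightarrow> d = N)}"

text \<open>Divisors and cofactors of smooth numbers are smooth, so divisibility of monomials is
  divisibility of weights and minimality may be tested on all integer divisors.\<close>

lemma bij_betw_min_weights: "bij_betw weight (min_expvecs (prime_count (real n)) n) (min_weights n)"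
proof -
  define E where "E = exponents (prime_count (real n))"
  have bij: "bij_betw weight E (smooth n)" unfolding E_def by (rule bij_betw_weight)
  have dvd_iff: "(\<exists>c. b = a + c) \<longleftrightarrow> weight a dvd weight b" if ab: "a \<in> E" "b \<in> E" for a b
  proof
    assume "weight a dvd weight b"
    then obtain k where k: "weight b = weight a * k" by (auto elim: dvdE)
    have wb: "weight b \<in> smooth n" using bij ab by (auto simp: bij_betw_def)
    have "k \<in> smooth n" by (rule smooth_dvd[OF wb]) (simp add: k)
    then obtain c where c: "c \<in> E" "k = weight c" using bij by (auto simp: bij_betw_def)
    have "a + c \<in> E" using ab c unfolding E_def by (intro exponents_add)
    moreover have "weight b = weight (a + c)" using k c by (simp add: weight_add)
    ultimately have "b = a + c" using bij ab by (auto simp: bij_betw_def dest: inj_onD)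
    then show "\<exists>c. b = a + c" by blast
  qed (auto simp: weight_add)
  have iff: "m \<in> min_expvecs (prime_count (real n)) n \<longleftrightarrow> weight m \<in> min_weights n" if m: "m \<in> E" for m
  proof -
    have wm: "weight m \<in> smooth n" using bij m by (auto simp: bij_betw_def)
    have "(\<forall>a\<in>E. weight a > n \<longrightarrow> (\<exists>c. m = a + c) \<longrightarrow> a = m) \<longleftrightarrow>
        (\<forall>a\<in>E. weight a > n \<longrightarrow> weight a dvd weight m \<longrightarrow> weight a = weight m)"
      by (intro ball_cong refl)
        (simp only: dvd_iff[OF _ m] inj_on_eq_iff[OF bij_betw_imp_inj_on[OF bij] _ m])
    also have "\<dots> \<longleftrightarrow> (\<forall>d\<in>smooth n. d > n \<longrightarrow> d dvd weight m \<longrightarrow> d = weight m)"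
      using bij_betw_imp_surj_on[OF bij, symmetric] by simp
    also have "\<dots> \<longleftrightarrow> (\<forall>d. d dvd weight m \<longrightarrow> d > n \<longrightarrow> d = weight m)"
      using smooth_dvd[OF wm] by blast
    finally show ?thesis
      using m wm unfolding min_expvecs_def min_weights_def E_def[symmetric] by blast
  qed
  have "min_expvecs (prime_count (real n)) n = {m \<in> E. weight m \<in> min_weights n}"
    using iff by (auto simp: min_expvecs_def E_def)
  moreover have "min_weights n \<subseteq> smooth n" by (auto simp: min_weights_def)
  ultimately show ?thesis
    using bij by (auto simp: bij_betw_def intro: inj_on_subset)
qed

lemma num_gens_eq_card_min_weights: "num_gens (K :: 'k::field itself) n = card (min_weights n)"
  unfolding num_gens_eq_card_min_expvecs by (rule bij_betw_same_card[OF bij_betw_min_weights])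

text \<open>A minimal generator of weight \<open>N\<close> is encoded by the least prime factor \<open>p\<close> of \<open>N\<close> and the
  part \<open>m\<close> of \<open>N\<close> prime to \<open>p\<close>: the exponent of \<open>p\<close> is the least \<open>a\<close> with \<open>p\<^sup>a m > n\<close>.\<close>

definition gen_codes :: "nat \<Rightarrow> (nat \<times> nat) set" where
  "gen_codes n = {(p, m). prime p \<and> p \<le> n \<and> 1 \<le> m \<and> m \<le> n \<and> (\<forall>q. prime q \<longrightarrow> q dvd m \<longrightarrow> p < q)}"

lemma gen_codes_decode:
  assumes pm: "(p, m) \<in> gen_codes n"
  obtains a where "(LEAST a. p ^ a * m > n) = Suc a" "p ^ a * m \<le> n" "p ^ Suc a * m > n"
proof -
  have p: "prime p" "1 \<le> m" "m \<le> n" using pm by (auto simp: gen_codes_def)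
  have "n < 2 ^ n" by (rule less_exp)
  also have "2 ^ n \<le> p ^ n" using prime_ge_2_nat[OF p(1)] by (rule power_mono) simp
  also have "p ^ n \<le> p ^ n * m" using p(2) by simp
  finally have ex: "p ^ n * m > n" .
  define A where "A = (LEAST a. p ^ a * m > n)"
  have A: "p ^ A * m > n" unfolding A_def by (rule LeastI[of _ n]) (rule ex)
  \<comment> \<open>For exponent 0 the product is \<open>m \<le> n\<close>, so the least exponent
    has a predecessor, whose product is still at most \<open>n\<close>.\<close>
  then have "A \<noteq> 0" using p by (cases "A = 0") auto
  then obtain a where a: "A = Suc a" by (cases A) auto
  have "\<not> p ^ a * m > n" using not_less_Least[of a "\<lambda>a. p ^ a * m > n"] a unfolding A_def by simp
  then show thesis using that[of a] A a unfolding A_def by simp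
qed

lemma not_dvd_gen_code:
  assumes "(p, m) \<in> gen_codes n" shows "\<not> p dvd m"
  using assms by (auto simp: gen_codes_def)

text \<open>The first component is the least prime factor of the image and the exponent its
  multiplicity, whence injectivity. The image is minimal because a proper divisor loses a prime
  factor of size at least p, so it is at most p^a m \<le> n, where a + 1 is the exponent.\<close>

lemma bij_betw_gen_codes:
  assumes n: "n \<ge> 1"
  shows "bij_betw (\<lambda>(p, m). p ^ (LEAST a. p ^ a * m > n) * m) (gen_codes n) (min_weights n)"
  unfolding bij_betw_def
proof (intro conjI inj_onI equalityI subsetI)
  fix x y assume xy: "x \<in> gen_codes n" "y \<in> gen_codes n"
    and eq: "(case x of (p, m) \<Rightarrow> p ^ (LEAST a. p ^ a * m > n) * m) = (case y of (p, m) \<Rightarrow> p ^ (LEAST a. p ^ a * m > n) * m)"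
  obtain p m q k where x: "x = (p, m)" and y: "y = (q, k)" by (cases x; cases y)
  note pm = xy(1)[unfolded x] and qk = xy(2)[unfolded y]
  obtain a where a: "(LEAST a. p ^ a * m > n) = Suc a" by (rule gen_codes_decode[OF pm])
  obtain b where b: "(LEAST a. q ^ a * k > n) = Suc b" by (rule gen_codes_decode[OF qk])
  have N: "p ^ Suc a * m = q ^ Suc b * k" using eq by (simp add: x y a b)
  have le: "p \<le> q" if "p ^ Suc a * m = q ^ Suc b * k" "(p, m) \<in> gen_codes n" "(q, k) \<in> gen_codes n" for p q m k a b
  proof -
    have q: "prime q" "prime p" using that by (auto simp: gen_codes_def)
    have "q dvd p ^ Suc a * m" unfolding that(1) by simp
    then have "q dvd p \<or> q dvd m" using q(1) by (metis prime_dvd_mult_iff prime_dvd_power)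
    then show ?thesis
    proof
      assume "q dvd p"
      then have "q = p" using q primes_dvd_imp_eq by blast
      then show ?thesis by simp
    next
      assume "q dvd m"
      then have "p < q" using that(2) q by (auto simp: gen_codes_def)
      then show ?thesis by simp
    qed
  qed
  have "p = q" using le[OF N pm qk] le[OF N[symmetric] qk pm] by simp
  moreover have "p \<noteq> 0" using pm prime_gt_0_nat[of p] by (auto simp: gen_codes_def)
  moreover have "multiplicity p (p ^ Suc a * m) = Suc a"
    using multiplicity_decomposeI[OF refl not_dvd_gen_code[OF pm] \<open>p \<noteq> 0\<close>] .
  moreover have "multiplicity p (p ^ Suc a * m) = Suc b"
    using multiplicity_decomposeI[OF N[unfolded \<open>p = q\<close>[symmetric]] _ \<open>p \<noteq> 0\<close>] not_dvd_gen_code[OF qk] \<open>p = q\<close> by simp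
  ultimately show "x = y" using N by (simp add: x y)
next
  fix N assume "N \<in> (\<lambda>(p, m). p ^ (LEAST a. p ^ a * m > n) * m) ` gen_codes n"
  then obtain p m where pm: "(p, m) \<in> gen_codes n" "N = p ^ (LEAST a. p ^ a * m > n) * m" by auto
  obtain a where a: "(LEAST a. p ^ a * m > n) = Suc a" "p ^ a * m \<le> n" "p ^ Suc a * m > n"
    by (rule gen_codes_decode[OF pm(1)])
  have N: "N = p ^ Suc a * m" using pm(2) a(1) by simp
  have p: "prime p" "p \<le> n" "1 \<le> m" "m \<le> n" using pm by (auto simp: gen_codes_def)
  have primes: "q = p \<or> (q dvd m \<and> p < q)" if "prime q" "q dvd N" for q
  proof -
    have "q dvd p \<or> q dvd m" using that unfolding N by (metis prime_dvd_mult_iff prime_dvd_power)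
    then show ?thesis using that(1) p(1) pm(1) primes_dvd_imp_eq[of q p] by (auto simp: gen_codes_def)
  qed
  have "N \<in> smooth n"
    unfolding smooth_def
  proof (intro CollectI conjI allI impI)
    show "N > 0" unfolding N by (rule le_less_trans[OF le0 a(3)])
    fix q assume "prime q" "q dvd N"
    then have "q = p \<or> q dvd m" using primes by blast
    then show "q \<le> n" using p dvd_imp_le[of q m] by auto
  qed
  moreover have "d = N" if d: "d dvd N" "d > n" for d
  proof (rule ccontr)
    assume "d \<noteq> N"
    obtain k where k: "N = d * k" using d by (auto elim: dvdE)
    have "k \<noteq> 1" using k \<open>d \<noteq> N\<close> by auto
    then obtain q where q: "prime q" "q dvd k" using prime_factor_nat by blast
    then have "p \<le> q" using primes[of q] k by auto
    moreover have "k > 0" using a N k by (cases "k = 0") auto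
    then have "q \<le> k" using q by (intro dvd_imp_le)
    ultimately have "d * p \<le> N" using k by simp
    also have "N = p ^ a * m * p" using N by simp
    finally have "d \<le> p ^ a * m" using prime_gt_0_nat[OF p(1)] by simp
    then show False using a d by simp
  qed
  ultimately show "N \<in> min_weights n" using a N by (simp add: min_weights_def)
next
  fix N assume N: "N \<in> min_weights n"
  then have Nn: "N > n" "N \<in> smooth n" and min: "\<And>d. d dvd N \<Longrightarrow> d > n \<Longrightarrow> d = N"
    by (auto simp: min_weights_def)
  have N0: "N > 0" using Nn by (simp add: smooth_def)
  have "N \<noteq> 1" using Nn(1) n by simp
  define p where "p = (LEAST p. prime p \<and> p dvd N)"
  have "prime p \<and> p dvd N"
    unfolding p_def using prime_factor_nat[OF \<open>N \<noteq> 1\<close>] by (rule LeastI_ex)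
  then have p: "prime p" "p dvd N" by auto
  have p_le: "p \<le> q" if "prime q" "q dvd N" for q
    unfolding p_def using that by (intro Least_le) simp
  obtain m where m: "N = p ^ multiplicity p N * m" "\<not> p dvd m"
    by (rule multiplicity_decompose'[of N p]) (use N0 p(1) in auto)
  have p1: "p > 1" using p(1) by (rule prime_gt_1_nat)
  then have "multiplicity p N \<noteq> 0" using p N0 multiplicity_gt_zero_iff[of N p] by simp
  then obtain a where a: "multiplicity p N = Suc a" by (cases "multiplicity p N") auto
  have Neq: "N = p ^ Suc a * m" using m(1) a by simp
  have "m > 0" using N0 Neq by (cases "m = 0") auto
  have proper: "d \<le> n" if "d dvd N" "d \<noteq> N" for d
    using min[of d] that by (meson not_le)
  have le_pow: "p ^ b * m \<le> n" if "b \<le> a" for b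
  proof (rule proper)
    show "p ^ b * m dvd N" unfolding Neq using that by (intro mult_dvd_mono le_imp_power_dvd) auto
    have "p ^ b < p ^ Suc a" using p1 that by (intro power_strict_increasing) auto
    then have "p ^ b * m < N" unfolding Neq using \<open>m > 0\<close> by simp
    then show "p ^ b * m \<noteq> N" by simp
  qed
  have "(LEAST a. p ^ a * m > n) = Suc a"
  proof (rule Least_equality)
    show "p ^ Suc a * m > n" using Nn(1) Neq by simp
    show "Suc a \<le> b" if "p ^ b * m > n" for b using le_pow[of b] that by (meson not_less_eq_eq not_le)
  qed
  then have "N = p ^ (LEAST a. p ^ a * m > n) * m" using Neq by simp
  moreover have "(p, m) \<in> gen_codes n"
  proof -
    have "p \<le> n" using Nn(2) p by (simp add: smooth_def)
    moreover have "m \<le> n" using le_pow[of 0] by simp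
    moreover have "p < q" if q: "prime q" "q dvd m" for q
    proof -
      have "q dvd N" using q(2) unfolding Neq by simp
      then have "p \<le> q" using q(1) by (intro p_le)
      moreover have "q \<noteq> p" using q(2) m(2) by auto
      ultimately show ?thesis by simp
    qed
    ultimately show ?thesis using p(1) \<open>m > 0\<close> by (simp add: gen_codes_def)
  qed
  ultimately show "N \<in> (\<lambda>(p, m). p ^ (LEAST a. p ^ a * m > n) * m) ` gen_codes n"
    by (metis (mono_tags, lifting) case_prod_conv image_eqI)
qed

section \<open>Counting\<close>

lemma card_less_pairs:
  fixes P :: "'a::linorder set"
  assumes "finite P"
  shows "2 * card {(p, q). p \<in> P \<and> q \<in> P \<and> p < q} + card P = card P * card P"
proof -
  define L where "L = {(p, q). p \<in> P \<and> q \<in> P \<and> p < q}"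
  define D where "D = (\<lambda>p. (p, p)) ` P"
  have fin: "finite L" unfolding L_def by (rule finite_subset[of _ "P \<times> P"]) (use assms in auto)
  have "P \<times> P = (L \<union> prod.swap ` L) \<union> D"
    by (auto simp: L_def D_def image_iff)
  moreover have "card ((L \<union> prod.swap ` L) \<union> D) = card (L \<union> prod.swap ` L) + card D"
    using fin assms by (intro card_Un_disjoint) (auto simp: L_def D_def)
  moreover have "card (L \<union> prod.swap ` L) = card L + card (prod.swap ` L)"
    using fin by (intro card_Un_disjoint) (auto simp: L_def)
  moreover have "card (prod.swap ` L) = card L" by (intro card_image) auto
  moreover have "card D = card P" unfolding D_def by (intro card_image) (auto simp: inj_on_def)
  ultimately show ?thesis using card_cartesian_product[of P P] by (simp add: L_def)
qed

definition odd_composites :: "nat \<Rightarrow> nat set" where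
  "odd_composites n = {m. odd m \<and> m \<le> n \<and> m \<noteq> 1 \<and> \<not> prime m}"

lemma finite_primes_le_real: "finite {p. prime p \<and> real p \<le> x}"
  by (rule finite_subset[of _ "{..nat \<lfloor>x\<rfloor>}"]) (auto simp: le_nat_floor)

text \<open>A composite \<open>m\<close> has a prime factor \<open>q\<close> whose cofactor again
  has a prime factor; both exceed \<open>p\<close>.\<close>

lemma composite_least_prime_sq_less:
  fixes p m :: nat
  assumes "m > 1" "\<not> prime m" and small: "\<And>q. prime q \<Longrightarrow> q dvd m \<Longrightarrow> p < q"
  shows "p * p < m"
proof -
  obtain q where q: "prime q" "q dvd m" using assms(1) prime_factor_nat[of m] by auto
  then obtain k where k: "m = q * k" by (auto elim: dvdE)
  have "k \<noteq> 1" using k q assms(2) by auto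
  then obtain q' where q': "prime q'" "q' dvd k" using prime_factor_nat by blast
  have "k > 0" using k assms(1) by (cases "k = 0") auto
  then have "q' \<le> k" using q' by (intro dvd_imp_le)
  moreover have "p < q'" using q' k by (intro small) auto
  moreover have "p < q" using q by (intro small)
  ultimately have "p * p < q * k" by (intro mult_strict_mono) auto
  then show ?thesis using k by simp
qed

text \<open>Codes with \<open>m = 1\<close> number \<pi>(n), those with \<open>m\<close> prime are
  the pairs of primes \<open>p < q \<le> n\<close>, and the two counts add up to the binomial
  coefficient. The excess is the number of codes with \<open>m\<close> composite.\<close>

lemma card_gen_codes:
  obtains E where "card (gen_codes n) = (prime_count (real n) + 1 choose 2) + E"
    "E \<le> prime_count (sqrt (real n)) * card (odd_composites n)"
proof -
  define P where "P = {p. prime p \<and> p \<le> n}"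
  define A where "A = {(p, m) \<in> gen_codes n. m = 1}"
  define L where "L = {(p, m) \<in> gen_codes n. prime m}"
  define Q where "Q = {(p, m) \<in> gen_codes n. m \<noteq> 1 \<and> \<not> prime m}"
  have finP: "finite P" unfolding P_def by (rule finite_primes_le)
  have fin: "finite (gen_codes n)"
    by (rule finite_subset[of _ "{..n} \<times> {..n}"]) (auto simp: gen_codes_def)
  then have fins: "finite A" "finite L" "finite Q"
    unfolding A_def L_def Q_def by (auto intro: finite_subset[of _ "gen_codes n"])
  have "gen_codes n = (A \<union> L) \<union> Q" by (auto simp: A_def L_def Q_def)
  moreover have "card ((A \<union> L) \<union> Q) = card (A \<union> L) + card Q"
    using fins by (intro card_Un_disjoint) (auto simp: A_def L_def Q_def)
  moreover have "card (A \<union> L) = card A + card L"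
    using fins by (intro card_Un_disjoint) (auto simp: A_def L_def)
  ultimately have card: "card (gen_codes n) = card A + card L + card Q" by simp
  have "A = (\<lambda>p. (p, 1)) ` P"
  proof (intro equalityI subsetI)
    fix x :: "nat \<times> nat" assume "x \<in> (\<lambda>p. (p, 1)) ` P"
    then obtain p where p: "prime p" "p \<le> n" "x = (p, 1)" by (auto simp: P_def)
    then have "1 \<le> n" using prime_ge_1_nat[of p] by simp
    then show "x \<in> A" using p by (auto simp: A_def gen_codes_def)
  qed (auto simp: A_def P_def gen_codes_def)
  then have "card A = card P" by (simp add: card_image inj_on_def)
  moreover have "L = {(p, q). p \<in> P \<and> q \<in> P \<and> p < q}"
  proof (intro equalityI subsetI)
    fix x assume "x \<in> {(p, q). p \<in> P \<and> q \<in> P \<and> p < q}"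
    then obtain p q where pq: "prime p" "p \<le> n" "prime q" "q \<le> n" "p < q" "x = (p, q)" by (auto simp: P_def)
    then have "p \<le> n" by simp
    have "p < l" if "prime l" "l dvd q" for l using primes_dvd_imp_eq[OF that(1) pq(3) that(2)] pq(5) by simp
    then show "x \<in> L" using pq prime_ge_1_nat[of q] \<open>p \<le> n\<close> by (simp add: L_def gen_codes_def)
  qed (auto simp: L_def P_def gen_codes_def)
  then have "2 * card L + card P = card P * card P" using card_less_pairs[OF finP] by simp
  ultimately have "2 * (card A + card L) = (card P + 1) * card P" by simp
  then have AL: "card A + card L = (prime_count (real n) + 1) choose 2"
    unfolding prime_count_nat P_def[symmetric] by (simp add: choose_two)
  have "Q \<subseteq> {p. prime p \<and> real p \<le> sqrt (real n)} \<times> odd_composites n"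
  proof safe
    fix p m assume "(p, m) \<in> Q"
    then have pm: "prime p" "1 \<le> m" "m \<le> n" "m \<noteq> 1" "\<not> prime m"
      and small: "\<And>q. prime q \<Longrightarrow> q dvd m \<Longrightarrow> p < q"
      by (auto simp: Q_def gen_codes_def)
    show "prime p" by (rule pm)
    have "p * p < m" using pm small by (intro composite_least_prime_sq_less) auto
    then have "p * p \<le> n" using pm by simp
    then have "real p * real p \<le> real n" by (simp flip: of_nat_mult)
    then show "real p \<le> sqrt (real n)" by (simp add: real_le_rsqrt power2_eq_square)
    \<comment> \<open>All prime factors of \<open>m\<close> exceed \<open>p \<ge> 2\<close>.\<close>
    have "\<not> 2 dvd m" using small[of 2] prime_ge_2_nat[OF pm(1)] by auto
    then show "m \<in> odd_composites n" using pm by (simp add: odd_composites_def)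
  qed
  moreover have "finite (odd_composites n)"
    by (rule finite_subset[of _ "{..n}"]) (auto simp: odd_composites_def)
  ultimately have "card Q \<le> card ({p. prime p \<and> real p \<le> sqrt (real n)} \<times> odd_composites n)"
    using finite_primes_le_real by (intro card_mono) auto
  then have "card Q \<le> prime_count (sqrt (real n)) * card (odd_composites n)"
    by (simp add: card_cartesian_product prime_count_def)
  then show thesis using that[of "card Q"] card AL by simp
qed

lemma card_odd_composites_le: "2 * card (odd_composites n) \<le> n"
proof -
  have "odd_composites n \<subseteq> (\<lambda>k. 2 * k + 1) ` {1..(n - 1) div 2}"
  proof
    fix m assume "m \<in> odd_composites n"
    then have m: "odd m" "m \<le> n" "m \<noteq> 1" by (auto simp: odd_composites_def)
    then obtain k where k: "m = 2 * k + 1" by (auto elim: oddE)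
    with m show "m \<in> (\<lambda>k. 2 * k + 1) ` {1..(n - 1) div 2}" by auto
  qed
  then have "card (odd_composites n) \<le> card ((\<lambda>k. 2 * k + 1) ` {1..(n - 1) div 2})"
    by (intro card_mono) auto
  also have "\<dots> \<le> card {1..(n - 1) div 2}" by (intro card_image_le) auto
  finally show ?thesis by simp
qed

lemma odd_composites_empty:
  assumes "n < 9"
  shows "odd_composites n = {}"
proof -
  have "prime m" if "odd m" "m \<le> n" "m \<noteq> 1" for m
  proof -
    have "m = 3 \<or> m = 5 \<or> m = 7" using that assms by presburger
    moreover have "prime (3::nat)" "prime (5::nat)" "prime (7::nat)" by simp_all
    ultimately show ?thesis by blast
  qed
  then show ?thesis by (auto simp: odd_composites_def)
qed

text \<open>The -1 on the right is paid for by the factor 1/2 in the count of odd composites: \<pi>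
  / 2 \<le> \<pi> - 1 as soon as \<pi> \<ge> 2, that is, once 3 \<le> \<surd>n. For
  \<open>4 \<le> n < 9\<close> the excess is 0 and \<pi> \<ge> 1 suffices.\<close>

lemma num_gens_bounds:
  fixes K :: "'k::field itself"
  assumes "n \<ge> 4"
  shows "0 \<le> real (num_gens K n) - real (prime_count (real n) + 1 choose 2)"
    and "real (num_gens K n) - real (prime_count (real n) + 1 choose 2)
      \<le> real n * (real (prime_count (sqrt (real n))) - 1)"
proof -
  obtain E where E: "card (gen_codes n) = (prime_count (real n) + 1 choose 2) + E"
    "E \<le> prime_count (sqrt (real n)) * card (odd_composites n)"
    by (rule card_gen_codes)
  have "num_gens K n = card (gen_codes n)"
    unfolding num_gens_eq_card_min_weights using assms
    by (intro bij_betw_same_card[OF bij_betw_gen_codes, symmetric]) simp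
  then have eq: "real (num_gens K n) - real (prime_count (real n) + 1 choose 2) = real E" using E(1) by simp
  show "0 \<le> real (num_gens K n) - real (prime_count (real n) + 1 choose 2)" unfolding eq by simp
  define \<pi> where "\<pi> = prime_count (sqrt (real n))"
  have "real E \<le> real n * (real \<pi> - 1)"
  proof (cases "n < 9")
    case True
    have "real 2 \<le> sqrt (real n)" using assms by (intro real_le_rsqrt) simp
    then have "card {2::nat} \<le> \<pi>"
      unfolding \<pi>_def prime_count_def by (intro card_mono finite_primes_le_real) auto
    then have "\<pi> \<ge> 1" by simp
    then show ?thesis using E(2) odd_composites_empty[OF True] by simp
  next
    case False
    have "real 2 \<le> sqrt (real n)" "real 3 \<le> sqrt (real n)" using False by (auto intro!: real_le_rsqrt)
    then have "card {2::nat, 3} \<le> \<pi>"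
      unfolding \<pi>_def prime_count_def by (intro card_mono finite_primes_le_real) auto
    then have \<pi>: "\<pi> \<ge> 2" by simp
    have "real E \<le> real \<pi> * real (card (odd_composites n))"
      using E(2) unfolding \<pi>_def by (simp flip: of_nat_mult)
    also have "\<dots> \<le> (2 * (real \<pi> - 1)) * (real n / 2)"
      using \<pi> card_odd_composites_le[of n] by (intro mult_mono) auto
    also have "\<dots> = real n * (real \<pi> - 1)" by simp
    finally show ?thesis .
  qed
  then show "real (num_gens K n) - real (prime_count (real n) + 1 choose 2)
      \<le> real n * (real (prime_count (sqrt (real n))) - 1)"
    unfolding eq \<pi>_def .
qed

section \<open>Asymptotic consequences\<close>

lemma prime_count_sqrt_le:
  "\<forall>\<^sub>F n::nat in at_top. real (prime_count (sqrt (real n))) \<le> 2 * sqrt (real n) / ln (sqrt (real n) - 1)"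
proof -
  \<comment> \<open>The limit law is known at integers only, so \<surd>n is replaced by its floor.
    This accounts for the -1 inside the logarithm; the constant 2 is simply larger than the limit
    1.\<close>
  have lim: "filterlim (\<lambda>n::nat. nat \<lfloor>sqrt (real n)\<rfloor>) at_top at_top"
    by (intro filterlim_compose[OF filterlim_nat_sequentially] filterlim_compose[OF filterlim_floor_sequentially]
        filterlim_compose[OF sqrt_at_top] filterlim_real_sequentially)
  have "\<forall>\<^sub>F k in at_top. real (prime_count (real k)) * ln (real k) / real k < 2"
    using prime_count_tendsto by (rule order_tendstoD) simp
  then have "\<forall>\<^sub>F n::nat in at_top. real (prime_count (real (nat \<lfloor>sqrt (real n)\<rfloor>))) * ln (real (nat \<lfloor>sqrt (real n)\<rfloor>)) / real (nat \<lfloor>sqrt (real n)\<rfloor>) < 2"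
    by (rule eventually_compose_filterlim[OF _ lim])
  moreover have "\<forall>\<^sub>F n::nat in at_top. sqrt (real n) > 3" by real_asymp
  ultimately show ?thesis
  proof eventually_elim
    case (elim n)
    define k where "k = nat \<lfloor>sqrt (real n)\<rfloor>"
    have k: "real k \<le> sqrt (real n)" "real k \<ge> sqrt (real n) - 1" using elim by (auto simp: k_def)
    have "real p \<le> sqrt (real n) \<longleftrightarrow> real p \<le> real k" for p
    proof -
      have "real p \<le> real k \<longleftrightarrow> p \<le> k" by simp
      also have "\<dots> \<longleftrightarrow> int p \<le> \<lfloor>sqrt (real n)\<rfloor>" unfolding k_def by (simp add: le_nat_iff)
      also have "\<dots> \<longleftrightarrow> real p \<le> sqrt (real n)" by (simp add: le_floor_iff)
      finally show ?thesis by simp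
    qed
    then have "prime_count (sqrt (real n)) = prime_count (real k)" by (simp add: prime_count_def)
    moreover have "real (prime_count (real k)) \<le> 2 * real k / ln (real k)"
      using elim k unfolding k_def[symmetric] by (simp add: field_simps)
    moreover have "2 * real k / ln (real k) \<le> 2 * sqrt (real n) / ln (sqrt (real n) - 1)"
    proof (intro frac_le)
      show "0 < ln (sqrt (real n) - 1)" using elim(2) by (intro ln_gt_zero) linarith
      have "0 < sqrt (real n) - 1" "0 < real k" using elim(2) k(2) by linarith+
      then show "ln (sqrt (real n) - 1) \<le> ln (real k)" using k(2) by simp
    qed (use k in simp_all)
    ultimately show ?case by simp
  qed
qed

lemma excess_bound_bigo:
  "(\<lambda>n::nat. real n * (real (prime_count (sqrt (real n))) - 1)) \<in> O[at_top](\<lambda>n. real n powr (3 / 2) / ln (real n))"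
proof -
  have "(\<lambda>n::nat. real n * (real (prime_count (sqrt (real n))) - 1)) \<in>
      O[at_top](\<lambda>n. real n * (2 * sqrt (real n) / ln (sqrt (real n) - 1)))"
  proof (rule landau_o.big_mono)
    have "\<forall>\<^sub>F n::nat in at_top. n \<ge> 4" by (rule eventually_ge_at_top)
    with prime_count_sqrt_le show "\<forall>\<^sub>F n::nat in at_top. norm (real n * (real (prime_count (sqrt (real n))) - 1))
        \<le> norm (real n * (2 * sqrt (real n) / ln (sqrt (real n) - 1)))"
    proof eventually_elim
      case (elim n)
      \<comment> \<open>Nonnegativity of the bound is read off from the two-sided estimate, for
        which any coefficient field will do.\<close>
      have "0 \<le> real n * (real (prime_count (sqrt (real n))) - 1)"
        using num_gens_bounds[OF elim(2), of "TYPE(real)"] by linarith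
      moreover have "real n * (real (prime_count (sqrt (real n))) - 1) \<le> real n * (2 * sqrt (real n) / ln (sqrt (real n) - 1))"
        using elim(1) by (intro mult_left_mono) auto
      ultimately show ?case by (simp only: real_norm_def)
    qed
  qed
  also have "(\<lambda>n::nat. real n * (2 * sqrt (real n) / ln (sqrt (real n) - 1))) \<in> O[at_top](\<lambda>n. real n powr (3 / 2) / ln (real n))"
    by real_asymp
  finally show ?thesis .
qed

lemma prime_count_sq_asymp_equiv:
  "(\<lambda>n::nat. real (prime_count (real n)) ^ 2 / 2) \<sim>[at_top] (\<lambda>n. real n ^ 2 / (2 * ln (real n) ^ 2))"
proof -
  have "(\<lambda>n::nat. real (prime_count (real n)) ^ 2 / 2) \<sim>[at_top] (\<lambda>n. (real n / ln (real n)) ^ 2 / 2)"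
    by (intro asymp_equiv_intros prime_number_theorem)
  then show ?thesis by (simp add: power_divide mult.commute)
qed

text \<open>The quotient is 1 + 1 / \<pi>(n), and \<pi>(n) tends to infinity.\<close>

lemma choose_prime_count_asymp_equiv:
  "(\<lambda>n::nat. real (prime_count (real n) + 1 choose 2)) \<sim>[at_top] (\<lambda>n. real (prime_count (real n)) ^ 2 / 2)"
proof (rule asymp_equivI')
  have "filterlim (\<lambda>n::nat. real n / ln (real n)) at_top at_top" by real_asymp
  then have top: "filterlim (\<lambda>n. real (prime_count (real n))) at_top at_top"
    using asymp_equiv_at_top_transfer[OF asymp_equiv_symI[OF prime_number_theorem]] by blast
  have "((\<lambda>n. 1 + 1 / real (prime_count (real n))) \<longlongrightarrow> 1 + 0) at_top"
    by (intro tendsto_intros tendsto_divide_0[OF tendsto_const] filterlim_at_top_imp_at_infinity top)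
  then have "((\<lambda>n. 1 + 1 / real (prime_count (real n))) \<longlongrightarrow> 1) at_top" by simp
  moreover have "\<forall>\<^sub>F n in at_top. real (prime_count (real n)) > 0"
    using top unfolding filterlim_at_top_dense by blast
  then have "\<forall>\<^sub>F n in at_top. 1 + 1 / real (prime_count (real n))
      = real (prime_count (real n) + 1 choose 2) / (real (prime_count (real n)) ^ 2 / 2)"
  proof eventually_elim
    case (elim n)
    define r where "r = prime_count (real n)"
    have "real ((r + 1) choose 2) = real (r + 1) * real r / 2"
      by (simp add: choose_two real_of_nat_div algebra_simps)
    moreover have "real (r + 1) * real r / 2 / (real r ^ 2 / 2) = 1 + 1 / real r"
      using elim unfolding r_def[symmetric] by (simp add: power2_eq_square add_divide_distrib)
    ultimately show ?case unfolding r_def[symmetric] by simp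
  qed
  ultimately show "((\<lambda>n. real (prime_count (real n) + 1 choose 2) / (real (prime_count (real n)) ^ 2 / 2)) \<longlongrightarrow> 1) at_top"
    by (rule Lim_transform_eventually)
qed

text \<open>The excess O(n^(3/2) / ln n) is of smaller order than n^2 / ln^2 n, which is the order
  of the binomial coefficient.\<close>

lemma num_gens_asymp_equiv:
  fixes K :: "'k::field itself"
  shows "(\<lambda>n::nat. real (num_gens K n)) \<sim>[at_top] (\<lambda>n. real (prime_count (real n) + 1 choose 2))"
proof (rule smallo_imp_asymp_equiv)
  have "(\<lambda>n. real (num_gens K n) - real (prime_count (real n) + 1 choose 2))
      \<in> O[at_top](\<lambda>n::nat. real n * (real (prime_count (sqrt (real n))) - 1))"
  proof (rule landau_o.big_mono)
    show "\<forall>\<^sub>F n in at_top. norm (real (num_gens K n) - real (prime_count (real n) + 1 choose 2))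
        \<le> norm (real n * (real (prime_count (sqrt (real n))) - 1))"
      using eventually_ge_at_top[of 4]
    proof eventually_elim
      case (elim n)
      then show ?case using num_gens_bounds[OF elim, of K] unfolding real_norm_def by linarith
    qed
  qed
  also note excess_bound_bigo
  also have "(\<lambda>n::nat. real n powr (3 / 2) / ln (real n)) \<in> o[at_top](\<lambda>n. real n ^ 2 / (2 * ln (real n) ^ 2))"
    by real_asymp
  also have "(\<lambda>n::nat. real n ^ 2 / (2 * ln (real n) ^ 2)) \<in> \<Theta>[at_top](\<lambda>n. real (prime_count (real n) + 1 choose 2))"
    by (intro asymp_equiv_imp_bigtheta asymp_equiv_symI[OF asymp_equiv_trans[OF choose_prime_count_asymp_equiv prime_count_sq_asymp_equiv]])
  finally show "(\<lambda>n. real (num_gens K n) - real (prime_count (real n) + 1 choose 2))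
      \<in> o[at_top](\<lambda>n. real (prime_count (real n) + 1 choose 2))" .
qed

theorem theorem18:
  fixes K :: "'k::field_char_0 itself"
  shows "(\<forall>n::nat. n \<ge> 4 \<longrightarrow>
            0 \<le> real (num_gens K n) - real ((prime_count (real n) + 1) choose 2) \<and>
            real (num_gens K n) - real ((prime_count (real n) + 1) choose 2)
              \<le> real n * (real (prime_count (sqrt (real n))) - 1)) \<and>
         (\<lambda>n::nat. real n * (real (prime_count (sqrt (real n))) - 1))
           \<in> O[at_top](\<lambda>n. real n powr (3 / 2) / ln (real n)) \<and>
         (\<lambda>n::nat. real (num_gens K n))
           \<sim>[at_top] (\<lambda>n. real ((prime_count (real n) + 1) choose 2)) \<and>
         (\<lambda>n::nat. real ((prime_count (real n) + 1) choose 2))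
           \<sim>[at_top] (\<lambda>n. real (prime_count (real n)) ^ 2 / 2) \<and>
         (\<lambda>n::nat. real (prime_count (real n)) ^ 2 / 2)
           \<sim>[at_top] (\<lambda>n. real n ^ 2 / (2 * ln (real n) ^ 2))"
  using num_gens_bounds[of _ K] excess_bound_bigo num_gens_asymp_equiv[of K]
    choose_prime_count_asymp_equiv prime_count_sq_asymp_equiv
  by blast

end
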